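(* Let $\delta>0$, $1\le p<\infty$ and $\lambda\in[0,1]$. Then $$\inf_{\|f\|_p=1}\|(\lambda I-B_\delta)f\|_p=0.$$
   Context: The Fourier transform of an integrable function $f$ on $\mathbb{R}^d$ is $\hat f(\xi)=\int_{\mathbb{R}^d} f(x)e^{-ix\xi}\,dx$, where $x\xi$ in the exponent is the inner product of $x$ and $\xi$; the definition is extended to all tempered distributions as usual. For $t\in\mathbb{R}$, $t_+=\max(t,0)$. For $\delta>0$, the Bochner-Riesz mean $B_\delta$ on $\mathbb{R}^d$ is the Fourier multiplier operator defined by $\widehat{B_\delta f}(\xi)=(1-|\xi|^2)_+^\delta\,\hat f(\xi)$. $I$ denotes the identity operator, and $\|\cdot\|_p$ denotes the norm of $L^p=L^p(\mathbb{R}^d)$, the space of all $p$-integrable functions on $\mathbb{R}^d$. *)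

theory Defs
  imports "HOL-Analysis.Analysis"
begin

definition fourier :: "('a::euclidean_space \<Rightarrow> complex) \<Rightarrow> 'a \<Rightarrow> complex" where
  "fourier f \<xi> = (LINT x|lborel. f x * exp (- \<i> * of_real (x \<bullet> \<xi>)))"

fun partial_derivs :: "'a::euclidean_space list \<Rightarrow> ('a \<Rightarrow> complex) \<Rightarrow> 'a \<Rightarrow> complex" where
  "partial_derivs [] f = f"
| "partial_derivs (b # bs) f = (\<lambda>x. frechet_derivative (partial_derivs bs f) (at x) b)"

text \<open>
  A list of basis vectors plays the role of a multi-index. Requiring every iterated partial
  derivative to be differentiable everywhere says that \<open>f\<close> is infinitely differentiable (and that
  \<open>frechet_derivative\<close> is never applied where no derivative exists).
\<close>
definition schwartz :: "('a::euclidean_space \<Rightarrow> complex) \<Rightarrow> bool" where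
  "schwartz f \<longleftrightarrow>
     (\<forall>bs. set bs \<subseteq> Basis \<longrightarrow>
        (\<forall>x. partial_derivs bs f differentiable (at x)) \<and>
        (\<forall>N::nat. bounded (range (\<lambda>x. of_real ((1 + norm x) ^ N) * partial_derivs bs f x))))"

text \<open>\<open>Lp p\<close> consists of functions, not of classes modulo null sets.\<close>
definition Lp :: "real \<Rightarrow> ('a::euclidean_space \<Rightarrow> complex) set" where
  "Lp p = {f \<in> borel_measurable lborel. integrable lborel (\<lambda>x. norm (f x) powr p)}"

definition Lp_norm :: "real \<Rightarrow> ('a::euclidean_space \<Rightarrow> complex) \<Rightarrow> ennreal" where
  "Lp_norm p f =
     (if f \<in> Lp p then ennreal ((LINT x|lborel. norm (f x) powr p) powr (1 / p)) else \<infinity>)"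

text \<open>
  \<open>fourier_multiplier m f g\<close> says that \<open>g\<close> is the image of \<open>f\<close> under the Fourier multiplier operator
  with symbol \<open>m\<close>: the Fourier transform of \<open>g\<close> is \<open>m\<close> times that of \<open>f\<close>, as tempered distributions.
  The transform of \<open>f\<close> is the distribution \<open>\<psi> \<mapsto> \<integral> f \<cdot> fourier \<psi>\<close>, and multiplying a distribution
  by \<open>m\<close> means multiplying the test function by \<open>m\<close>.

  It is a relation because for large \<open>p\<close> and small \<open>\<delta>\<close> the Bochner-Riesz mean is not bounded on
  \<open>L\<^sup>p\<close>: the image of \<open>f\<close> need not lie in \<open>L\<^sup>p\<close>, and the integral of \<open>f\<close> against
  \<open>fourier (m \<psi>)\<close> need not converge (\<open>m \<psi>\<close> is not smooth), in which case no \<open>g\<close> is related to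
  \<open>f\<close>. If \<open>g\<close> exists, it is unique almost everywhere.
\<close>
definition fourier_multiplier ::
    "('a::euclidean_space \<Rightarrow> complex) \<Rightarrow> ('a \<Rightarrow> complex) \<Rightarrow> ('a \<Rightarrow> complex) \<Rightarrow> bool" where
  "fourier_multiplier m f g \<longleftrightarrow>
     f \<in> borel_measurable lborel \<and> g \<in> borel_measurable lborel \<and>
     (\<forall>\<psi>. schwartz \<psi> \<longrightarrow>
        integrable lborel (\<lambda>x. f x * fourier \<psi> x) \<and>
        integrable lborel (\<lambda>x. f x * fourier (\<lambda>\<xi>. m \<xi> * \<psi> \<xi>) x) \<and>
        integrable lborel (\<lambda>x. g x * fourier \<psi> x) \<and>
        (LINT x|lborel. g x * fourier \<psi> x) =
        (LINT x|lborel. f x * fourier (\<lambda>\<xi>. m \<xi> * \<psi> \<xi>) x))"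

definition bochner_riesz ::
    "real \<Rightarrow> ('a::euclidean_space \<Rightarrow> complex) \<Rightarrow> ('a \<Rightarrow> complex) \<Rightarrow> bool" where
  "bochner_riesz \<delta> = fourier_multiplier (\<lambda>\<xi>. of_real (max (1 - (norm \<xi>)\<^sup>2) 0 powr \<delta>))"

text \<open>
  The \<open>L\<^sup>p\<close> norm of \<open>(lam I - B) f\<close>, where \<open>B\<close> is the Bochner-Riesz mean of order \<open>\<delta>\<close>. The infimum
  over \<open>g\<close> just selects the almost everywhere unique \<open>g = B f\<close>; the value is \<open>\<infinity>\<close> if \<open>B f\<close> is not
  defined or \<open>(lam I - B) f\<close> is not in \<open>L\<^sup>p\<close>.
\<close>
definition shifted_bochner_riesz_norm ::
    "real \<Rightarrow> real \<Rightarrow> real \<Rightarrow> ('a::euclidean_space \<Rightarrow> complex) \<Rightarrow> ennreal" where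
  "shifted_bochner_riesz_norm p lam \<delta> f =
     (INF g \<in> {g. bochner_riesz \<delta> f g}. Lp_norm p (\<lambda>x. of_real lam * f x - g x))"

end

theory Submission
  imports Defs "HOL-Probability.Sinc_Integral"
begin

text \<open>
  Near a suitable frequency \<open>\<xi>\<^sub>0\<close> the symbol of the Bochner-Riesz mean agrees with an absolutely
  convergent trigonometric series \<open>M\<close> with \<open>M(\<xi>\<^sub>0) = lam\<close>. If \<open>lam = 0\<close>, take \<open>\<bar>\<xi>\<^sub>0\<bar> = 2\<close> and \<open>M = 0\<close>.
  Otherwise take \<open>\<bar>\<xi>\<^sub>0\<bar> < 1\<close> with \<open>(1 - \<bar>\<xi>\<^sub>0\<bar>\<^sup>2)\<^sup>\<delta> = lam\<close>: since \<open>s = \<epsilon> arcsin (sin (s/\<epsilon>))\<close> for small \<open>s\<close> and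
  the coefficients of the arcsine series are summable, each coordinate of \<open>\<xi> - \<xi>\<^sub>0\<close> agrees near \<open>0\<close>
  with a trigonometric series of small \<open>\<ell>\<^sup>1\<close> norm, and the binomial series for \<open>(1 - \<bar>\<xi>\<bar>\<^sup>2)\<^sup>\<delta>\<close>
  around \<open>\<xi>\<^sub>0\<close> converges in this norm. On functions with spectrum near \<open>\<xi>\<^sub>0\<close> the Bochner-Riesz mean
  is therefore an absolutely convergent combination of translations. Test functions are
  \<open>exp(i x \<xi>\<^sub>0)\<close> times a product of dilated squares of sinc functions: their spectrum is compact and
  shrinks to \<open>\<xi>\<^sub>0\<close>, and up to the phase \<open>exp(i y \<xi>\<^sub>0)\<close> a translation by \<open>y\<close> changes them by a
  proportion of their norm that tends to \<open>0\<close>. No bound on the whole operator is needed,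
  so that all \<open>p\<close> and \<open>\<delta>\<close> are covered.
\<close>

section \<open>Absolutely convergent trigonometric series\<close>

text \<open>The sign is that of the kernel in \<open>fourier\<close>, so that
  \<open>character y\<close> is the symbol of the translation by \<open>y\<close>; see
  \<open>fourier_translate\<close>.\<close>

abbreviation character :: "'a::euclidean_space \<Rightarrow> 'a \<Rightarrow> complex" where
  "character y \<xi> \<equiv> exp (- \<i> * of_real (y \<bullet> \<xi>))"

lemma norm_exp_ii [simp]: "norm (exp (\<i> * complex_of_real t)) = 1" "norm (exp (- (\<i> * complex_of_real t))) = 1"
  by (simp_all add: norm_exp_eq_Re)

text \<open>These functions are the Fourier transforms of finite purely atomic complex measures,
  which form a Banach algebra. \<open>C\<close> is only an upper bound for the sum of the moduli of
  the coefficients, and the points \<open>y k\<close> may repeat, so like terms never have to be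
  collected.\<close>

definition trig_series :: "real \<Rightarrow> ('a::euclidean_space \<Rightarrow> complex) \<Rightarrow> bool" where
  "trig_series C \<mu> \<longleftrightarrow> (\<exists>a y. summable (\<lambda>k::nat. norm (a k)) \<and> (\<Sum>k. norm (a k)) \<le> C \<and>
     (\<forall>\<xi>. \<mu> \<xi> = (\<Sum>k. a k * character (y k) \<xi>)))"

lemma trig_series_norm_le:
  assumes "trig_series C \<mu>"
  shows "norm (\<mu> \<xi>) \<le> C"
proof -
  obtain a and y :: "nat \<Rightarrow> 'a" where a: "summable (\<lambda>k. norm (a k))" "(\<Sum>k. norm (a k)) \<le> C"
    and \<mu>: "\<mu> \<xi> = (\<Sum>k. a k * character (y k) \<xi>)"
    using assms unfolding trig_series_def by blast
  have "norm (\<mu> \<xi>) \<le> (\<Sum>k. norm (a k * character (y k) \<xi>))"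
    unfolding \<mu> by (rule summable_norm) (use a in \<open>simp add: norm_mult\<close>)
  also have "\<dots> \<le> C" using a by (simp add: norm_mult)
  finally show ?thesis .
qed

lemma trig_series_nonneg:
  assumes "trig_series C \<mu>"
  shows "0 \<le> C"
  using trig_series_norm_le[OF assms, of 0] norm_ge_zero order_trans by blast

text \<open>The double series is absolutely summable, hence it may be enumerated along
  \<open>prod_decode\<close>. Sums, products and power series below all reduce to this
  lemma.\<close>

lemma trig_series_suminf:
  fixes \<mu> :: "nat \<Rightarrow> 'a::euclidean_space \<Rightarrow> complex"
  assumes ap: "\<And>k. trig_series (C k) (\<mu> k)" and C: "summable C"
  shows "trig_series (\<Sum>k. C k) (\<lambda>\<xi>. \<Sum>k. \<mu> k \<xi>)"
proof -
  have "\<forall>k. \<exists>a y. summable (\<lambda>j::nat. norm (a j)) \<and> (\<Sum>j. norm (a j)) \<le> C k \<and>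
     (\<forall>\<xi>. \<mu> k \<xi> = (\<Sum>j. a j * character (y j) \<xi>))"
    using ap unfolding trig_series_def by blast
  from choice[OF this] obtain a where "\<forall>k. \<exists>y. summable (\<lambda>j::nat. norm (a k j)) \<and>
     (\<Sum>j. norm (a k j)) \<le> C k \<and> (\<forall>\<xi>. \<mu> k \<xi> = (\<Sum>j. a k j * character (y j) \<xi>))"
    by blast
  from choice[OF this] obtain y where a: "\<And>k. summable (\<lambda>j. norm (a k j))" "\<And>k. (\<Sum>j. norm (a k j)) \<le> C k"
    and \<mu>: "\<And>k \<xi>. \<mu> k \<xi> = (\<Sum>j. a k j * character (y k j :: 'a) \<xi>)"
    by blast
  define S where "S k = (\<Sum>j. norm (a k j))" for k
  have S0: "0 \<le> S k" for k unfolding S_def by (intro suminf_nonneg a) auto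
  have hs: "((\<lambda>j. norm (a k j)) has_sum S k) UNIV" for k
    unfolding S_def by (intro sums_nonneg_imp_has_sum summable_sums a) auto
  have sS: "summable S"
    by (rule summable_comparison_test[OF _ C]) (use a S0 in \<open>auto simp: S_def\<close>)
  have hS: "(S has_sum suminf S) UNIV"
    by (intro sums_nonneg_imp_has_sum summable_sums sS S0)
  have bij: "bij_betw prod_decode UNIV (UNIV::(nat \<times> nat) set)"
    by (rule bij_prod_decode)
  \<comment> \<open>The value type is generic because the claim is used over the reals for the
    moduli of the coefficients and over the complex numbers for the series itself.\<close>
  have sums_diag: "(\<lambda>n. case prod_decode n of (k,j) \<Rightarrow> F k j) sums (\<Sum>k. f k)"
    if F: "\<And>k j. norm (F k j) = norm (a k j)" and f: "\<And>k. f k = (\<Sum>j. F k j)"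
    for F :: "nat \<Rightarrow> nat \<Rightarrow> 'z::banach" and f
  proof -
    have Fk: "((F k) has_sum f k) UNIV" for k
      unfolding f by (intro norm_summable_imp_has_sum[OF _ summable_sums[OF summable_norm_cancel[of "F k"]]])
        (simp_all add: F a)
    have infF: "infsum (\<lambda>j. norm (F k j)) UNIV = S k" for k
      using hs[of k] by (simp add: F infsumI)
    have abs: "(\<lambda>x. norm ((\<lambda>(k,j). F k j) x)) summable_on (UNIV \<times> UNIV)"
    proof (rule iffD2[OF Infinite_Sum.abs_summable_on_Sigma_iff[of "\<lambda>(k,j). F k j" UNIV "\<lambda>_. UNIV"]], intro conjI ballI)
      show "(\<lambda>j. norm ((\<lambda>(k,j). F k j) (k, j))) summable_on UNIV" for k
        using hs[of k] by (simp add: F has_sum_iff)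
      show "(\<lambda>k. norm (infsum (\<lambda>j. norm ((\<lambda>(k,j). F k j) (k, j))) UNIV)) summable_on UNIV"
        using hS S0 by (simp add: infF has_sum_iff)
    qed
    then have sm: "(\<lambda>(k,j). F k j) summable_on (UNIV \<times> UNIV)" by (rule abs_summable_summable)
    have nf: "norm (f k) \<le> S k" for k
      unfolding f S_def using summable_norm[of "F k"] by (simp add: F a)
    have snf: "summable (\<lambda>k. norm (f k))"
      by (rule summable_comparison_test[OF _ sS]) (use nf in auto)
    have hf: "(f has_sum (\<Sum>k. f k)) UNIV"
      by (intro norm_summable_imp_has_sum summable_sums snf summable_norm_cancel[OF snf])
    have "infsum (\<lambda>(k,j). F k j) (UNIV \<times> UNIV) = infsum (\<lambda>k. infsum (\<lambda>j. F k j) UNIV) UNIV"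
      using infsum_Sigma_banach[OF sm] by simp
    also have "\<dots> = (\<Sum>k. f k)" using Fk hf by (simp add: has_sum_iff)
    finally have "((\<lambda>(k,j). F k j) has_sum (\<Sum>k. f k)) UNIV"
      using sm by (simp add: has_sum_iff)
    then have "((\<lambda>n. (\<lambda>(k,j). F k j) (prod_decode n)) has_sum (\<Sum>k. f k)) UNIV"
      using has_sum_reindex_bij_betw[OF bij] by blast
    then show ?thesis by (rule has_sum_imp_sums)
  qed
  define b where "b n = (case prod_decode n of (k,j) \<Rightarrow> a k j)" for n
  define z where "z n = (case prod_decode n of (k,j) \<Rightarrow> y k j)" for n
  have 1: "(\<lambda>n. norm (b n)) sums (\<Sum>k. S k)"
    using sums_diag[of "\<lambda>k j. norm (a k j)" S] by (simp add: b_def S_def prod.case_distrib)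
  have 2: "(\<lambda>n. b n * character (z n) \<xi>) sums (\<Sum>k. \<mu> k \<xi>)" for \<xi>
  proof -
    have "(\<lambda>n. b n * character (z n) \<xi>) = (\<lambda>n. case prod_decode n of (k,j) \<Rightarrow> a k j * character (y k j) \<xi>)"
      by (auto simp: b_def z_def split: prod.split)
    then show ?thesis
      using sums_diag[of "\<lambda>k j. a k j * character (y k j) \<xi>" "\<lambda>k. \<mu> k \<xi>"] by (simp add: \<mu> norm_mult)
  qed
  have "(\<Sum>k. S k) \<le> (\<Sum>k. C k)"
    using a by (intro suminf_le sS C) (simp add: S_def)
  then show ?thesis
    unfolding trig_series_def using 1 2 by (intro exI[of _ b] exI[of _ z]) (auto simp: sums_iff)
qed

lemma trig_series_mono:
  assumes "trig_series C \<mu>" "C \<le> D"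
  shows "trig_series D \<mu>"
  using assms unfolding trig_series_def by (meson order_trans)

lemma trig_series_character:
  "trig_series (norm c) (\<lambda>\<xi>. c * character y \<xi>)"
proof -
  let ?a = "\<lambda>k::nat. if k = 0 then c else 0"
  have 1: "(\<lambda>k. norm (?a k)) sums norm c"
    using sums_single[of 0 "\<lambda>_. norm c"] by (simp add: if_distrib cong: if_cong)
  have 2: "(\<lambda>k. ?a k * character y \<xi>) sums (c * character y \<xi>)" for \<xi>
  proof -
    have "(\<lambda>k. ?a k * character y \<xi>) = (\<lambda>k. if k = 0 then c * character y \<xi> else 0)" by auto
    then show ?thesis using sums_single[of 0 "\<lambda>_. c * character y \<xi>"] by simp
  qed
  show ?thesis unfolding trig_series_def
    using 1 2 by (intro exI[of _ ?a] exI[of _ "\<lambda>_. y"]) (auto simp: sums_iff)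
qed

lemma trig_series_const: "trig_series (norm c) (\<lambda>\<xi>. c)"
  using trig_series_character[of c 0] by simp

lemma trig_series_add:
  assumes "trig_series C \<mu>" "trig_series D \<nu>"
  shows "trig_series (C + D) (\<lambda>\<xi>. \<mu> \<xi> + \<nu> \<xi>)"
proof -
  let ?C = "\<lambda>k::nat. if k = 0 then C else if k = 1 then D else 0"
  let ?\<mu> = "\<lambda>k::nat. if k = 0 then \<mu> else if k = 1 then \<nu> else (\<lambda>_. 0)"
  have fin: "(\<lambda>k. if k = 0 then u else if k = 1 then v else 0) sums (u + v)"
    for u v :: "'z::real_normed_vector"
    using sums_finite[of "{0,1}" "\<lambda>k. if k = 0 then u else if k = 1 then v else 0"] by simp
  have "trig_series (\<Sum>k. ?C k) (\<lambda>\<xi>. \<Sum>k. ?\<mu> k \<xi>)"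
    using assms trig_series_const[of 0] fin[of C D]
    by (intro trig_series_suminf) (auto simp: sums_iff)
  also have "(\<Sum>k. ?C k) = C + D" using fin[of C D] by (simp add: sums_iff)
  also have "(\<lambda>\<xi>. \<Sum>k. ?\<mu> k \<xi>) = (\<lambda>\<xi>. \<mu> \<xi> + \<nu> \<xi>)"
  proof
    fix \<xi> show "(\<Sum>k. ?\<mu> k \<xi>) = \<mu> \<xi> + \<nu> \<xi>"
      using fin[of "\<mu> \<xi>" "\<nu> \<xi>"] by (simp add: sums_iff if_distribR cong: if_cong)
  qed
  finally show ?thesis .
qed

lemma trig_series_mult_character:
  assumes "trig_series C \<mu>"
  shows "trig_series (norm c * C) (\<lambda>\<xi>. c * character y \<xi> * \<mu> \<xi>)"
proof -
  obtain a and z :: "nat \<Rightarrow> 'a" where a: "summable (\<lambda>k. norm (a k))" "(\<Sum>k. norm (a k)) \<le> C"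
    and \<mu>: "\<And>\<xi>. \<mu> \<xi> = (\<Sum>k. a k * character (z k) \<xi>)"
    using assms unfolding trig_series_def by blast
  have eq: "c * a k * character (y + z k) \<xi> = c * character y \<xi> * (a k * character (z k) \<xi>)" for k \<xi>
    by (simp add: exp_add[symmetric] inner_add_left algebra_simps flip: exp_add)
  have "summable (\<lambda>k. a k * character (z k) \<xi>)" for \<xi>
    by (rule summable_norm_cancel) (use a in \<open>simp add: norm_mult\<close>)
  from suminf_mult[OF this]
  have "c * character y \<xi> * \<mu> \<xi> = (\<Sum>k. c * a k * character (y + z k) \<xi>)" for \<xi>
    unfolding eq \<mu> by simp
  moreover have "(\<Sum>k. norm (c * a k)) \<le> norm c * C"
    using a by (simp add: norm_mult suminf_mult mult_left_mono)
  moreover have "summable (\<lambda>k. norm (c * a k))"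
    using a by (simp add: norm_mult summable_mult)
  ultimately show ?thesis
    unfolding trig_series_def by (intro exI[of _ "\<lambda>k. c * a k"] exI[of _ "\<lambda>k. y + z k"]) simp
qed

lemma trig_series_cmult:
  assumes "trig_series C \<mu>"
  shows "trig_series (norm c * C) (\<lambda>\<xi>. c * \<mu> \<xi>)"
  using trig_series_mult_character[OF assms, of c 0] by simp

text \<open>Expanding only the first factor gives a series of multiples of \<nu> by characters, to
  which \<open>trig_series_suminf\<close> applies; no Cauchy product is formed.\<close>

lemma trig_series_mult:
  assumes \<mu>: "trig_series C \<mu>" and \<nu>: "trig_series D \<nu>"
  shows "trig_series (C * D) (\<lambda>\<xi>. \<mu> \<xi> * \<nu> \<xi>)"
proof -
  obtain a and z :: "nat \<Rightarrow> 'a" where a: "summable (\<lambda>k. norm (a k))" "(\<Sum>k. norm (a k)) \<le> C"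
    and \<mu>: "\<And>\<xi>. \<mu> \<xi> = (\<Sum>k. a k * character (z k) \<xi>)"
    using \<mu> unfolding trig_series_def by blast
  have "trig_series (\<Sum>k. norm (a k) * D) (\<lambda>\<xi>. \<Sum>k. a k * character (z k) \<xi> * \<nu> \<xi>)"
    using a by (intro trig_series_suminf trig_series_mult_character \<nu> summable_mult2)
  also have "(\<lambda>\<xi>. \<Sum>k. a k * character (z k) \<xi> * \<nu> \<xi>) = (\<lambda>\<xi>. \<mu> \<xi> * \<nu> \<xi>)"
  proof
    fix \<xi>
    have "summable (\<lambda>k. a k * character (z k) \<xi>)"
      by (rule summable_norm_cancel) (use a in \<open>simp add: norm_mult\<close>)
    from suminf_mult2[OF this, of "\<nu> \<xi>"]
    show "(\<Sum>k. a k * character (z k) \<xi> * \<nu> \<xi>) = \<mu> \<xi> * \<nu> \<xi>" by (simp add: \<mu>)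
  qed
  finally show ?thesis
    by (rule trig_series_mono)
      (use a trig_series_nonneg[OF \<nu>] in \<open>simp add: suminf_mult2[symmetric] mult_right_mono\<close>)
qed

lemma trig_series_power:
  assumes "trig_series C \<mu>"
  shows "trig_series (C ^ n) (\<lambda>\<xi>. \<mu> \<xi> ^ n)"
proof (induction n)
  case 0
  then show ?case using trig_series_const[of 1] by simp
next
  case (Suc n)
  then show ?case using trig_series_mult[OF assms Suc] by simp
qed

text \<open>Functional calculus: a power series that converges absolutely at the bound
  \<open>C\<close> can be applied to the trigonometric series.\<close>

lemma trig_series_powser:
  assumes "trig_series C \<mu>" "summable (\<lambda>n. norm (c n) * C ^ n)"
  shows "trig_series (\<Sum>n. norm (c n) * C ^ n) (\<lambda>\<xi>. \<Sum>n. c n * \<mu> \<xi> ^ n)"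
  by (intro trig_series_suminf trig_series_cmult trig_series_power assms)

lemma trig_series_sum:
  assumes "finite I" "\<And>i. i \<in> I \<Longrightarrow> trig_series (C i) (\<mu> i)"
  shows "trig_series (\<Sum>i\<in>I. C i) (\<lambda>\<xi>. \<Sum>i\<in>I. \<mu> i \<xi>)"
  using assms
proof (induction I rule: finite_induct)
  case empty
  then show ?case using trig_series_const[of 0] by simp
next
  case (insert i I)
  then show ?case by (simp add: trig_series_add)
qed

section \<open>Power series of the arcsine\<close>

text \<open>Integrating the binomial series of (1 - x^2)^(-1/2) gives nonnegative coefficients. The
  partial sums on (0, 1) are at most pi / 2, and letting x tend to 1 shows that the coefficients are
  summable. This endpoint case matters because the sine, as a trigonometric series, has coefficient
  sum exactly 1.\<close>

lemma arcsin_powser: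
  obtains c :: "nat \<Rightarrow> real" where "\<And>n. 0 \<le> c n" "summable c"
    "\<And>x. \<bar>x\<bar> < 1 \<Longrightarrow> (\<lambda>n. c n * x ^ Suc (2 * n)) sums arcsin x"
proof -
  \<comment> \<open>Coefficient of \<open>x ^ (2 * n)\<close> in 1 / sqrt (1 - x^2); the sign makes
    it nonnegative.\<close>
  define b :: "nat \<Rightarrow> real" where "b n = (- (1/2) gchoose n) * (-1) ^ n" for n
  define c where "c n = b n / real (Suc (2 * n))" for n
  have b: "(\<lambda>n. b n * (x\<^sup>2) ^ n) sums (1 / sqrt (1 - x\<^sup>2))" if "\<bar>x\<bar> < 1" for x
  proof -
    have x2: "x\<^sup>2 < 1" using that by (simp add: abs_square_less_1)
    have "(\<lambda>n. (- (1/2) gchoose n) * (- x\<^sup>2) ^ n) sums (1 + - x\<^sup>2) powr (- (1/2))"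
      by (rule gen_binomial_real) (use x2 in simp)
    also have "(1 + - x\<^sup>2) powr (- (1/2)) = 1 / sqrt (1 - x\<^sup>2)"
      using x2 by (simp add: powr_minus_divide powr_half_sqrt)
    also have "(\<lambda>n. (- (1/2) gchoose n) * (- x\<^sup>2) ^ n) = (\<lambda>n. b n * (x\<^sup>2) ^ n)"
      by (simp add: b_def power_minus[of "x\<^sup>2"] fun_eq_iff)
    finally show ?thesis .
  qed
  have b0: "0 \<le> b n" for n
  proof -
    have "b n = pochhammer (1/2) n / fact n"
      by (simp add: b_def gbinomial_pochhammer)
    then show ?thesis by (simp add: pochhammer_nonneg)
  qed
  then have c0: "0 \<le> c n" for n by (simp add: c_def)
  \<comment> \<open>The same coefficients spread over the odd exponents, so that termwise
    differentiation applies.\<close>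
  define f where "f n = (if even n then 0 else c (n div 2))" for n
  have diffs_f: "diffs f n = (if even n then b (n div 2) else 0)" for n
    by (auto simp: diffs_def f_def c_def elim!: evenE oddE)
  have re: "strict_mono (\<lambda>n::nat. 2 * n)" "strict_mono (\<lambda>n::nat. Suc (2 * n))"
    by (auto simp: strict_mono_def)
  have dsums: "(\<lambda>n. diffs f n * x ^ n) sums (1 / sqrt (1 - x\<^sup>2))" if "\<bar>x\<bar> < 1" for x
  proof (subst sums_mono_reindex[OF re(1), symmetric])
    show "diffs f n * x ^ n = 0" if "n \<notin> range (\<lambda>n. 2 * n)" for n
      using that by (auto simp: diffs_f elim!: evenE)
    show "(\<lambda>n. diffs f (2 * n) * x ^ (2 * n)) sums (1 / sqrt (1 - x\<^sup>2))"
      using b[OF that] by (simp add: diffs_f power_mult)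
  qed
  have fs: "summable (\<lambda>n. f n * x ^ n)" if "\<bar>x\<bar> < 1" for x
  proof -
    obtain K where K: "\<bar>x\<bar> < K" "K < 1" using dense[of "\<bar>x\<bar>" 1] \<open>\<bar>x\<bar> < 1\<close> by blast
    have "summable (\<lambda>n. norm (diffs f n * \<bar>x\<bar> ^ n))"
      by (rule powser_insidea[OF sums_summable[OF dsums[of K]]]) (use K in simp_all)
    then have sd: "summable (\<lambda>n. \<bar>diffs f n\<bar> * \<bar>x\<bar> ^ n)" by (simp add: abs_mult power_abs)
    have "summable (\<lambda>n. f (Suc n) * x ^ Suc n)"
    proof (rule summable_comparison_test[OF _ sd], intro exI allI impI)
      fix n
      have "norm (f (Suc n) * x ^ Suc n) = \<bar>f (Suc n)\<bar> * (\<bar>x\<bar> * \<bar>x\<bar> ^ n)"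
        by (simp add: abs_mult power_abs)
      also have "\<dots> \<le> \<bar>f (Suc n)\<bar> * \<bar>x\<bar> ^ n"
        using that by (intro mult_left_mono mult_left_le_one_le) auto
      also have "\<dots> \<le> \<bar>diffs f n\<bar> * \<bar>x\<bar> ^ n"
        unfolding diffs_def abs_mult abs_of_nat
        by (intro mult_right_mono zero_le_power abs_ge_zero) (simp add: mult_le_cancel_right1)
      finally show "norm (f (Suc n) * x ^ Suc n) \<le> \<bar>diffs f n\<bar> * \<bar>x\<bar> ^ n" .
    qed
    then show ?thesis by (subst (asm) summable_Suc_iff)
  qed
  define g where "g x = (\<Sum>n. f n * x ^ n)" for x
  have g': "(g has_real_derivative 1 / sqrt (1 - x\<^sup>2)) (at x)" if "\<bar>x\<bar> < 1" for x
    unfolding g_def using termdiffs_strong'[of 1 f x] fs that dsums[OF that]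
    by (simp add: sums_iff)
  have gar: "g x = arcsin x" if "\<bar>x\<bar> < 1" for x
  proof -
    have "\<exists>k. \<forall>x\<in>{-1<..<1}. g x - arcsin x = k"
    proof (rule has_field_derivative_zero_constant)
      show "convex {-1<..<1::real}" by simp
      fix x :: real assume x: "x \<in> {-1<..<1}"
      then have "((\<lambda>x. g x - arcsin x) has_real_derivative 1 / sqrt (1 - x\<^sup>2) - inverse (sqrt (1 - x\<^sup>2))) (at x)"
        by (intro DERIV_diff g' DERIV_arcsin) auto
      then show "((\<lambda>x. g x - arcsin x) has_real_derivative 0) (at x within {-1<..<1})"
        by (simp add: divide_inverse has_field_derivative_at_within)
    qed
    then obtain k where k: "\<And>x. x \<in> {-1<..<1} \<Longrightarrow> g x - arcsin x = k" by blast
    have "g 0 = 0" by (simp add: g_def powser_zero f_def)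
    with k[of 0] k[of x] that show ?thesis by (simp add: abs_less_iff)
  qed
  have sums: "(\<lambda>n. c n * x ^ Suc (2 * n)) sums arcsin x" if "\<bar>x\<bar> < 1" for x
  proof -
    have "(\<lambda>n. f n * x ^ n) sums arcsin x"
      using summable_sums[OF fs[OF that]] gar[OF that] by (simp add: g_def)
    then have "(\<lambda>n. f (Suc (2 * n)) * x ^ Suc (2 * n)) sums arcsin x"
      by (subst sums_mono_reindex[OF re(2)]) (auto simp: f_def elim!: oddE)
    then show ?thesis by (simp add: f_def)
  qed
  have "summable c"
  proof (rule summableI_nonneg_bounded[OF c0])
    fix N
    have "((\<lambda>x. \<Sum>n<N. c n * x ^ Suc (2 * n)) \<longlongrightarrow> (\<Sum>n<N. c n * 1 ^ Suc (2 * n))) (at_left 1)"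
      by (intro tendsto_intros)
    moreover have "eventually (\<lambda>x. (\<Sum>n<N. c n * x ^ Suc (2 * n)) \<le> pi / 2) (at_left (1::real))"
    proof -
      have "(\<Sum>n<N. c n * x ^ Suc (2 * n)) \<le> pi / 2" if "0 < x" "x < 1" for x
      proof -
        have "(\<Sum>n<N. c n * x ^ Suc (2 * n)) \<le> arcsin x"
          using sums[of x] that c0 sum_le_suminf[of "\<lambda>n. c n * x ^ Suc (2 * n)" "{..<N}"]
          by (auto simp: sums_iff)
        also have "\<dots> \<le> pi / 2" using that by (intro arcsin_ubound) auto
        finally show ?thesis .
      qed
      then show ?thesis
        using eventually_at_left_real[of 0 1] by (auto elim!: eventually_mono)
    qed
    ultimately show "sum c {..<N} \<le> pi / 2"
      using tendsto_upperbound[of _ _ "at_left (1::real)"] by fastforce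
  qed
  from that[OF c0 this sums] show ?thesis .
qed

section \<open>The local form of the Bochner-Riesz symbol\<close>

text \<open>\<open>C\<close> is the sum of the arcsine coefficients. It depends neither on the
  centre nor on the direction nor on \<epsilon>, so the bound shrinks linearly with the box; this
  smallness is what later makes the binomial series converge.\<close>

lemma coordinate_trig_series:
  obtains C where "\<And>(\<xi>0::'a::euclidean_space) b \<epsilon>. 0 < \<epsilon> \<Longrightarrow>
    \<exists>S. trig_series (\<epsilon> * C) S \<and> (\<forall>\<xi>. \<bar>(\<xi> - \<xi>0) \<bullet> b\<bar> \<le> \<epsilon> \<longrightarrow> S \<xi> = of_real ((\<xi> - \<xi>0) \<bullet> b))"
proof -
  obtain c :: "nat \<Rightarrow> real" where c: "\<And>n. 0 \<le> c n" "summable c"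
    and arcsin: "\<And>x. \<bar>x\<bar> < 1 \<Longrightarrow> (\<lambda>n. c n * x ^ Suc (2 * n)) sums arcsin x"
    using arcsin_powser by blast
  have "\<exists>S. trig_series (\<epsilon> * suminf c) S \<and> (\<forall>\<xi>. \<bar>(\<xi> - \<xi>0) \<bullet> b\<bar> \<le> \<epsilon> \<longrightarrow> S \<xi> = of_real ((\<xi> - \<xi>0) \<bullet> b))"
    if \<epsilon>: "0 < \<epsilon>" for \<xi>0 b :: 'a and \<epsilon>
  proof -
    define u where "u \<xi> = (\<xi> - \<xi>0) \<bullet> b / \<epsilon>" for \<xi>
    define s where "s \<xi> = complex_of_real (sin (u \<xi>))" for \<xi>
    \<comment> \<open>Euler's formula for the sine, with the phase coming from \<xi>0 absorbed into
      coefficients of modulus 1/2.\<close>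
    define c1 c2 where "c1 = exp (- \<i> * of_real (\<xi>0 \<bullet> b / \<epsilon>)) / (2 * \<i>)"
      and "c2 = - exp (\<i> * of_real (\<xi>0 \<bullet> b / \<epsilon>)) / (2 * \<i>)"
    have "s \<xi> = c1 * character (- (b /\<^sub>R \<epsilon>)) \<xi> + c2 * character (b /\<^sub>R \<epsilon>) \<xi>" for \<xi>
    proof -
      have "s \<xi> = (exp (\<i> * of_real (u \<xi>)) - exp (- (\<i> * of_real (u \<xi>)))) / (2 * \<i>)"
        by (simp add: s_def sin_of_real[symmetric] sin_exp_eq)
      also have "exp (\<i> * of_real (u \<xi>)) = exp (- \<i> * of_real (\<xi>0 \<bullet> b / \<epsilon>)) * character (- (b /\<^sub>R \<epsilon>)) \<xi>"
        by (simp add: exp_add[symmetric] u_def inner_diff_left inner_commute diff_divide_distrib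
              algebra_simps divide_inverse)
      also have "exp (- (\<i> * of_real (u \<xi>))) = exp (\<i> * of_real (\<xi>0 \<bullet> b / \<epsilon>)) * character (b /\<^sub>R \<epsilon>) \<xi>"
        by (simp add: exp_add[symmetric] u_def inner_diff_left inner_commute diff_divide_distrib
              algebra_simps divide_inverse)
      finally show ?thesis by (simp add: c1_def c2_def diff_divide_distrib algebra_simps)
    qed
    then have s_eq: "s = (\<lambda>\<xi>. c1 * character (- (b /\<^sub>R \<epsilon>)) \<xi> + c2 * character (b /\<^sub>R \<epsilon>) \<xi>)"
      by (rule ext)
    have "trig_series (norm c1 + norm c2) s"
      unfolding s_eq by (intro trig_series_add trig_series_character)
    moreover have "norm c1 + norm c2 = 1"
      by (simp add: c1_def c2_def norm_divide norm_mult norm_exp_eq_Re)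
    ultimately have s: "trig_series 1 s" by simp
    define S where "S \<xi> = of_real \<epsilon> * (\<Sum>n. of_real (c n) * s \<xi> ^ Suc (2 * n))" for \<xi>
    have "trig_series (c n) (\<lambda>\<xi>. of_real (c n) * s \<xi> ^ Suc (2 * n))" for n
      using trig_series_cmult[OF trig_series_power[OF s], of "of_real (c n)" "Suc (2 * n)"] c by simp
    from trig_series_cmult[OF trig_series_suminf[OF this c(2)], of "of_real \<epsilon>"] \<epsilon>
    have "trig_series (\<epsilon> * suminf c) S" by (simp add: S_def[abs_def])
    moreover have "S \<xi> = of_real ((\<xi> - \<xi>0) \<bullet> b)" if "\<bar>(\<xi> - \<xi>0) \<bullet> b\<bar> \<le> \<epsilon>" for \<xi>
    proof -
      \<comment> \<open>Since 1 < pi / 2, \<open>u \<xi>\<close> lies where arcsin inverts sin, and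
        its sine lies strictly inside the unit interval, where the series is known to converge to
        arcsin.\<close>
      have u: "\<bar>u \<xi>\<bar> \<le> 1" using that \<epsilon> by (simp add: u_def)
      then have u': "- (pi / 2) < u \<xi>" "u \<xi> < pi / 2" using pi_gt3 by auto
      then have "0 < cos (u \<xi>)" by (rule cos_gt_zero_pi)
      then have "(sin (u \<xi>))\<^sup>2 < 1" by (simp add: sin_squared_eq)
      then have "(\<lambda>n. c n * sin (u \<xi>) ^ Suc (2 * n)) sums u \<xi>"
        using arcsin[of "sin (u \<xi>)"] u' by (simp add: abs_square_less_1 arcsin_sin)
      from sums_of_real[OF this, where 'a = complex]
      have "(\<Sum>n. of_real (c n) * s \<xi> ^ Suc (2 * n)) = of_real (u \<xi>)"
        by (simp add: s_def sums_iff)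
      then show ?thesis using \<epsilon> unfolding S_def by (simp add: u_def)
    qed
    ultimately show ?thesis by blast
  qed
  then show ?thesis by (rule that)
qed

text \<open>For \<open>lam > 0\<close> put a = 1 - |\<xi>0|^2 = lam^(1/\<delta>) and v = (|\<xi>|^2
  - |\<xi>0|^2) / a. For v < 1 the symbol equals lam (1 - v)^\<delta>, and v is a quadratic
  polynomial in the coordinates of \<xi> - \<xi>0 without constant term, hence a trigonometric
  series of small norm near \<xi>0.\<close>

lemma bochner_riesz_symbol_local:
  fixes \<delta> lam :: real
  assumes \<delta>: "0 < \<delta>" and lam: "0 \<le> lam" "lam \<le> 1"
  obtains \<xi>0 :: "'a::euclidean_space" and \<epsilon> C M where "0 < \<epsilon>" "trig_series C M" "M \<xi>0 = of_real lam"
    "\<And>\<xi>. (\<And>b. b \<in> Basis \<Longrightarrow> \<bar>(\<xi> - \<xi>0) \<bullet> b\<bar> \<le> \<epsilon>) \<Longrightarrow>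
      of_real (max (1 - (norm \<xi>)\<^sup>2) 0 powr \<delta>) = M \<xi>"
proof (cases "lam = 0")
  case True
  obtain b :: 'a where b: "b \<in> Basis" using nonempty_Basis by blast
  \<comment> \<open>The box of radius 1 around \<open>2 *\<^sub>R b\<close> misses the open unit
    ball, so the symbol vanishes on it.\<close>
  have "of_real (max (1 - (norm \<xi>)\<^sup>2) 0 powr \<delta>) = (0::complex)"
    if "\<And>c. c \<in> Basis \<Longrightarrow> \<bar>(\<xi> - 2 *\<^sub>R b) \<bullet> c\<bar> \<le> 1" for \<xi>
  proof -
    have "\<bar>\<xi> \<bullet> b - 2\<bar> \<le> 1" using that[OF b] b by (simp add: inner_diff_left)
    then have "1 \<le> norm \<xi>" using Basis_le_norm[OF b, of \<xi>] by linarith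
    then have "1 \<le> (norm \<xi>)\<^sup>2" by simp
    then show ?thesis by (simp add: max_def)
  qed
  then show ?thesis
    using that[of 1 0 "\<lambda>_. 0" "2 *\<^sub>R b"] trig_series_const[of 0] True by simp
next
  case False
  define a where "a = lam powr (1 / \<delta>)"
  have a: "0 < a" "a \<le> 1" "a powr \<delta> = lam"
    using False lam \<delta> by (auto simp: a_def powr_powr intro!: powr_le1)
  obtain e :: 'a where e: "e \<in> Basis" using nonempty_Basis by blast
  define \<xi>0 where "\<xi>0 = sqrt (1 - a) *\<^sub>R e"
  have \<xi>0: "(norm \<xi>0)\<^sup>2 = 1 - a" using a e by (simp add: \<xi>0_def)
  obtain C where C: "\<And>(\<xi>0::'a) b \<epsilon>. 0 < \<epsilon> \<Longrightarrow>
    \<exists>S. trig_series (\<epsilon> * C) S \<and> (\<forall>\<xi>. \<bar>(\<xi> - \<xi>0) \<bullet> b\<bar> \<le> \<epsilon> \<longrightarrow> S \<xi> = of_real ((\<xi> - \<xi>0) \<bullet> b))"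
    using coordinate_trig_series by blast
  have C0: "0 \<le> C" using C[of 1] trig_series_nonneg by fastforce
  \<comment> \<open>\<open>\<epsilon> * Q\<close> will bound the coefficients of \<open>w\<close>,
    and this choice of \<epsilon> makes it less than 1.\<close>
  define Q where "Q = DIM('a) * (C\<^sup>2 + 2 * C) / a"
  define \<epsilon> where "\<epsilon> = 1 / (1 + Q)"
  have Q: "0 \<le> Q" using C0 a by (simp add: Q_def)
  then have \<epsilon>: "0 < \<epsilon>" "\<epsilon> \<le> 1" "\<epsilon> * Q < 1" by (auto simp: \<epsilon>_def divide_simps)
  obtain S where S: "\<And>b. trig_series (\<epsilon> * C) (S b)"
    and S_eq: "\<And>b \<xi>. \<bar>(\<xi> - \<xi>0) \<bullet> b\<bar> \<le> \<epsilon> \<Longrightarrow> S b \<xi> = of_real ((\<xi> - \<xi>0) \<bullet> b)"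
    using C[OF \<epsilon>(1), of \<xi>0] by metis
  \<comment> \<open>The trigonometric form of v: with s = (\<xi> - \<xi>0) \<bullet> b, the
    difference |\<xi>|^2 - |\<xi>0|^2 is the sum over \<open>b\<close> of s^2 + 2 (\<xi>0 \<bullet>
    b) s.\<close>
  define w where "w \<xi> = of_real (1 / a) * (\<Sum>b\<in>Basis. S b \<xi> * S b \<xi> + of_real (2 * (\<xi>0 \<bullet> b)) * S b \<xi>)" for \<xi>
  have w: "trig_series (\<epsilon> * Q) w"
  proof (rule trig_series_mono)
    show "trig_series (norm (complex_of_real (1 / a)) *
       (\<Sum>b\<in>(Basis::'a set). \<epsilon> * C * (\<epsilon> * C) + norm (complex_of_real (2 * (\<xi>0 \<bullet> b))) * (\<epsilon> * C))) w"
      unfolding w_def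
      by (intro trig_series_cmult trig_series_sum trig_series_add trig_series_mult S finite_Basis)
    have "(\<Sum>b\<in>(Basis::'a set). \<epsilon> * C * (\<epsilon> * C) + norm (complex_of_real (2 * (\<xi>0 \<bullet> b))) * (\<epsilon> * C))
        \<le> (\<Sum>b\<in>(Basis::'a set). \<epsilon> * (C\<^sup>2 + 2 * C))"
    proof (rule sum_mono)
      fix b :: 'a assume b: "b \<in> Basis"
      have "(norm \<xi>0)\<^sup>2 \<le> 1" using \<xi>0 a by simp
      then have "norm \<xi>0 \<le> 1" by (simp add: abs_square_le_1)
      then have "\<bar>\<xi>0 \<bullet> b\<bar> \<le> 1" using Basis_le_norm[OF b, of \<xi>0] by linarith
      then have "norm (complex_of_real (2 * (\<xi>0 \<bullet> b))) * (\<epsilon> * C) \<le> 2 * (\<epsilon> * C)"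
        using \<epsilon> C0 by (intro mult_right_mono) (auto simp: norm_mult)
      moreover have "\<epsilon> * (\<epsilon> * C\<^sup>2) \<le> 1 * (\<epsilon> * C\<^sup>2)" using \<epsilon> by (intro mult_right_mono) auto
      ultimately show "\<epsilon> * C * (\<epsilon> * C) + norm (complex_of_real (2 * (\<xi>0 \<bullet> b))) * (\<epsilon> * C) \<le> \<epsilon> * (C\<^sup>2 + 2 * C)"
        by (simp add: power2_eq_square algebra_simps)
    qed
    also have "\<dots> = \<epsilon> * Q * a" using a by (simp add: Q_def)
    finally show "norm (complex_of_real (1 / a)) *
       (\<Sum>b\<in>(Basis::'a set). \<epsilon> * C * (\<epsilon> * C) + norm (complex_of_real (2 * (\<xi>0 \<bullet> b))) * (\<epsilon> * C)) \<le> \<epsilon> * Q"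
      using a by (simp add: divide_simps mult_ac norm_divide)
  qed
  define \<gamma> where "\<gamma> n = (\<delta> gchoose n) * (-1) ^ n" for n
  \<comment> \<open>Convergence of the binomial series at the larger point \<open>K\<close> gives
    absolute convergence at \<open>\<epsilon> * Q\<close>.\<close>
  obtain K where K: "\<epsilon> * Q < K" "K < 1" using \<epsilon>(3) dense by blast
  have \<epsilon>Q: "0 \<le> \<epsilon> * Q" using \<epsilon> Q by simp
  have "summable (\<lambda>n. (\<delta> gchoose n) * K ^ n)"
    using K \<epsilon>Q by (intro sums_summable[OF gen_binomial_real]) auto
  then have "summable (\<lambda>n. norm ((\<delta> gchoose n) * (\<epsilon> * Q) ^ n))"
    by (rule powser_insidea) (use K \<epsilon>Q in auto)
  then have "summable (\<lambda>n. norm (complex_of_real (\<gamma> n)) * (\<epsilon> * Q) ^ n)"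
    using \<epsilon> Q by (simp add: \<gamma>_def norm_mult norm_power abs_mult power_abs)
  from trig_series_cmult[OF trig_series_powser[OF w this], of "of_real lam"]
  obtain C' where M: "trig_series C' (\<lambda>\<xi>. of_real lam * (\<Sum>n. of_real (\<gamma> n) * w \<xi> ^ n))" by blast
  have eq: "of_real (max (1 - (norm \<xi>)\<^sup>2) 0 powr \<delta>) = of_real lam * (\<Sum>n. of_real (\<gamma> n) * w \<xi> ^ n)"
    if box: "\<And>b. b \<in> Basis \<Longrightarrow> \<bar>(\<xi> - \<xi>0) \<bullet> b\<bar> \<le> \<epsilon>" for \<xi>
  proof -
    define v where "v = ((norm \<xi>)\<^sup>2 - (norm \<xi>0)\<^sup>2) / a"
    have "(\<Sum>b\<in>Basis. S b \<xi> * S b \<xi> + of_real (2 * (\<xi>0 \<bullet> b)) * S b \<xi>) =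
        of_real (\<Sum>b\<in>Basis. (\<xi> \<bullet> b) * (\<xi> \<bullet> b) - (\<xi>0 \<bullet> b) * (\<xi>0 \<bullet> b))"
      unfolding of_real_sum
      by (intro sum.cong refl, subst (1 2 3) S_eq[OF box])
        (auto simp: inner_diff_left algebra_simps)
    also have "\<dots> = of_real ((norm \<xi>)\<^sup>2 - (norm \<xi>0)\<^sup>2)"
      by (simp add: power2_norm_eq_inner sum_subtractf euclidean_inner[of \<xi> \<xi>] euclidean_inner[of \<xi>0 \<xi>0])
    finally have wv: "w \<xi> = of_real v" by (simp add: w_def v_def)
    \<comment> \<open>The coefficient bound of \<open>w\<close> also bounds its values, and on the
      box \<open>w\<close> agrees with \<open>v\<close>.\<close>
    have v: "\<bar>v\<bar> < 1" using trig_series_norm_le[OF w, of \<xi>] \<epsilon> by (simp add: wv)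
    have av: "1 - (norm \<xi>)\<^sup>2 = a * (1 - v)" using a by (simp add: v_def \<xi>0 field_simps)
    have "(\<lambda>n. (\<delta> gchoose n) * (- v) ^ n) sums (1 + - v) powr \<delta>"
      by (rule gen_binomial_real) (use v in simp)
    then have "(\<lambda>n. \<gamma> n * v ^ n) sums (1 - v) powr \<delta>"
      by (simp add: \<gamma>_def power_minus[of v] mult_ac)
    from sums_of_real[OF this, where 'a = complex]
    have "(\<Sum>n. of_real (\<gamma> n) * w \<xi> ^ n) = of_real ((1 - v) powr \<delta>)" by (simp add: wv sums_iff)
    moreover have "max (1 - (norm \<xi>)\<^sup>2) 0 powr \<delta> = lam * (1 - v) powr \<delta>"
      using a v by (simp add: av max_def powr_mult mult_le_0_iff)
    ultimately show ?thesis by simp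
  qed
  have "of_real (max (1 - (norm \<xi>0)\<^sup>2) 0 powr \<delta>) = complex_of_real lam" using a by (simp add: \<xi>0)
  with eq[of \<xi>0] \<epsilon> have "of_real lam * (\<Sum>n. of_real (\<gamma> n) * w \<xi>0 ^ n) = of_real lam" by simp
  with that[OF \<epsilon>(1) M _ eq] show ?thesis by blast
qed

section \<open>Band-limited functions\<close>

text \<open>\<open>lborel\<close> is the image of a product of one-dimensional Lebesgue measures
  under the coordinate map, so Fubini's theorem factors the integral.\<close>

lemma
  fixes h :: "'a::euclidean_space \<Rightarrow> real \<Rightarrow> 'b::{real_normed_field,banach,second_countable_topology}"
  assumes h: "\<And>b. b \<in> Basis \<Longrightarrow> integrable lborel (h b)"
  shows integrable_lborel_prod: "integrable lborel (\<lambda>x::'a. \<Prod>b\<in>Basis. h b (x \<bullet> b))" (is ?I)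
    and integral_lborel_prod:
      "(LINT x|lborel. (\<Prod>b\<in>Basis. h b ((x::'a) \<bullet> b))) = (\<Prod>b\<in>Basis. (LINT t|lborel. h b t))" (is ?E)
proof -
  interpret product_sigma_finite "\<lambda>_::'a. lborel :: real measure" by standard
  have [measurable]: "h b \<in> borel_measurable borel" if "b \<in> Basis" for b
    using borel_measurable_integrable[OF h[OF that]] by simp
  have [measurable]: "(\<lambda>x::'a. \<Prod>b\<in>Basis. h b (x \<bullet> b)) \<in> borel_measurable borel"
    by measurable
  have eq: "(\<Prod>b\<in>Basis. h b ((\<Sum>c\<in>Basis. f c *\<^sub>R c) \<bullet> b)) = (\<Prod>b\<in>Basis. h b (f b))"
    for f :: "'a \<Rightarrow> real"
    by (intro prod.cong) auto
  show ?I
    by (subst lborel_eq, subst integrable_distr_eq) (auto simp: eq intro!: product_integrable_prod h)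
  show ?E
    by (subst lborel_eq, subst integral_distr) (auto simp: eq intro!: product_integral_prod h)
qed

lemma integrable_inverse_1_plus_sq: "integrable lborel (\<lambda>t::real. inverse (1 + t\<^sup>2))"
proof -
  have "set_integrable lborel (einterval (-\<infinity>) \<infinity>) (\<lambda>t::real. inverse (1 + t\<^sup>2))"
    using integrable_inverse_1_plus_square by simp
  then show ?thesis by (simp add: set_integrable_def)
qed

section \<open>The squared sinc function and its Fourier transform\<close>

text \<open>Up to scaling this is the Fejer kernel of the line. Its Fourier transform is a triangle
  function supported on [-2, 2]. The square is taken because sinc itself is not integrable.\<close>

definition sincsq :: "real \<Rightarrow> real" where
  "sincsq t = (sinc t)\<^sup>2"

lemma continuous_on_sincsq: "continuous_on A sincsq"
  unfolding sincsq_def by (intro continuous_intros)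

lemma borel_measurable_sincsq [measurable]: "sincsq \<in> borel_measurable borel"
  unfolding sincsq_def by measurable

lemma sincsq_nonneg: "0 \<le> sincsq t"
  by (simp add: sincsq_def)

lemma sincsq_minus [simp]: "sincsq (- t) = sincsq t"
  by (cases "t = 0") (simp_all add: sincsq_def)

lemma sincsq_le_1: "sincsq t \<le> 1"
proof -
  have "(sin t)\<^sup>2 \<le> t\<^sup>2" by (simp add: abs_le_square_iff[symmetric] abs_sin_x_le_abs_x)
  then show ?thesis by (simp add: sincsq_def power_divide)
qed

lemma divide_le_mult_inverse:
  fixes c q s x :: real
  assumes "x * q \<le> c * s" "0 < q" "0 < s"
  shows "x / s \<le> c * inverse q"
  using assms by (simp add: divide_simps)

text \<open>Sum of the bounds (sin t)^2 \<le> t^2, effective near 0, and (sin t)^2 \<le> 1,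
  effective at infinity.\<close>

lemma sincsq_le: "sincsq t \<le> 2 * inverse (1 + t\<^sup>2)"
proof (cases "t = 0")
  case False
  have "(sin t)\<^sup>2 \<le> t\<^sup>2" by (simp add: abs_le_square_iff[symmetric] abs_sin_x_le_abs_x)
  moreover have "(sin t)\<^sup>2 * t\<^sup>2 \<le> 1 * t\<^sup>2"
    by (intro mult_right_mono) (auto simp: abs_square_le_1)
  ultimately have "(sin t)\<^sup>2 * (1 + t\<^sup>2) \<le> 2 * t\<^sup>2" by (simp add: distrib_left)
  moreover have "0 < 1 + t\<^sup>2" "0 < t\<^sup>2" using False by (auto simp: add_pos_nonneg)
  ultimately have "(sin t)\<^sup>2 / t\<^sup>2 \<le> 2 * inverse (1 + t\<^sup>2)" by (intro divide_le_mult_inverse)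
  then show ?thesis using False by (simp add: sincsq_def power_divide)
qed (simp add: sincsq_def)

lemma integrable_sincsq: "integrable lborel sincsq"
  by (rule Bochner_Integration.integrable_bound[OF integrable_mult_right[OF integrable_inverse_1_plus_sq, of 2]])
    (use sincsq_le in \<open>auto simp: sincsq_nonneg\<close>)

lemma integrable_one_minus_cos_div_sq: "integrable lborel (\<lambda>t::real. (1 - cos (a * t)) / t\<^sup>2)"
proof (rule Bochner_Integration.integrable_bound[OF integrable_mult_right[OF integrable_inverse_1_plus_sq, of "a\<^sup>2 / 2 + 2"]])
  show "AE t in lborel. norm ((1 - cos (a * t)) / t\<^sup>2) \<le> norm ((a\<^sup>2 / 2 + 2) * inverse (1 + t\<^sup>2))"
  proof (rule AE_I2)
    fix t :: real
    have s: "1 - cos (a * t) = 2 * (sin (a * t / 2))\<^sup>2"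
      using cos_double_sin[of "a * t / 2"] by simp
    have "(sin (a * t / 2))\<^sup>2 \<le> (a * t / 2)\<^sup>2"
      by (simp only: abs_le_square_iff[symmetric] abs_sin_x_le_abs_x)
    then have 1: "1 - cos (a * t) \<le> a\<^sup>2 / 2 * t\<^sup>2"
      unfolding s by (simp add: power_mult_distrib power_divide)
    have "(1 - cos (a * t)) * t\<^sup>2 \<le> 2 * t\<^sup>2"
      by (intro mult_right_mono) (use cos_ge_minus_one[of "a * t"] in auto)
    with 1 have "(1 - cos (a * t)) * (1 + t\<^sup>2) \<le> (a\<^sup>2 / 2 + 2) * t\<^sup>2"
      by (simp add: algebra_simps)
    moreover have "0 < 1 + t\<^sup>2" by (auto simp: add_pos_nonneg)
    ultimately have "(1 - cos (a * t)) / t\<^sup>2 \<le> (a\<^sup>2 / 2 + 2) * inverse (1 + t\<^sup>2)" if "t \<noteq> 0"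
      using that by (intro divide_le_mult_inverse) auto
    then show "norm ((1 - cos (a * t)) / t\<^sup>2) \<le> norm ((a\<^sup>2 / 2 + 2) * inverse (1 + t\<^sup>2))"
      by (cases "t = 0") auto
  qed
qed simp

text \<open>Substitution of \<open>a * t\<close>. The remaining constant is pi, but it can stay
  symbolic because \<open>integral_sincsq_cos\<close> multiplies it by 0.\<close>

lemma integral_one_minus_cos_div_sq:
  fixes a :: real
  shows "(LINT t|lborel. (1 - cos (a * t)) / t\<^sup>2) = \<bar>a\<bar> * (LINT t|lborel. (1 - cos t) / t\<^sup>2)"
proof (cases "a = 0")
  case False
  have "(LINT t|lborel. (1 - cos t) / t\<^sup>2) = \<bar>a\<bar> * (LINT t|lborel. (1 - cos (a * t)) / (a * t)\<^sup>2)"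
    using lborel_integral_real_affine[OF False, of "\<lambda>t. (1 - cos t) / t\<^sup>2" 0] by simp
  also have "(\<lambda>t. (1 - cos (a * t)) / (a * t)\<^sup>2) = (\<lambda>t. inverse (a\<^sup>2) * ((1 - cos (a * t)) / t\<^sup>2))"
    by (simp add: power_mult_distrib field_simps)
  also have "(LINT t|lborel. inverse (a\<^sup>2) * ((1 - cos (a * t)) / t\<^sup>2)) =
      inverse (a\<^sup>2) * (LINT t|lborel. (1 - cos (a * t)) / t\<^sup>2)"
    by (rule integral_mult_right_zero)
  finally have "\<bar>a\<bar> * (LINT t|lborel. (1 - cos t) / t\<^sup>2) =
      \<bar>a\<bar> * \<bar>a\<bar> * inverse (a\<^sup>2) * (LINT t|lborel. (1 - cos (a * t)) / t\<^sup>2)"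
    by (simp only: mult.assoc)
  also have "\<bar>a\<bar> * \<bar>a\<bar> * inverse (a\<^sup>2) = 1"
    using False by (simp add: power2_eq_square field_simps)
  finally show ?thesis by simp
qed simp

text \<open>
  On multiplying out, the integrand is a second difference of \<open>\<eta> \<mapsto> (1 - cos (\<eta> t)) / t\<^sup>2\<close>, whose
  integral is proportional to \<open>\<bar>\<eta>\<bar>\<close>, a function that is affine on either side of the origin.
\<close>
lemma integral_sincsq_cos:
  assumes "2 \<le> \<bar>\<eta>\<bar>"
  shows "(LINT t|lborel. sincsq t * cos (\<eta> * t)) = 0"
proof -
  define J where "J a t = (1 - cos (a * t)) / t\<^sup>2" for a t :: real
  have iJ: "integrable lborel (J a)" "(LINT t|lborel. J a t) = \<bar>a\<bar> * (LINT t|lborel. (1 - cos t) / t\<^sup>2)" for a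
    unfolding J_def by (rule integrable_one_minus_cos_div_sq integral_one_minus_cos_div_sq)+
  have [measurable]: "J a \<in> borel_measurable borel" for a
    unfolding J_def by measurable
  \<comment> \<open>At \<open>t = 0\<close> the left side is 1, whereas the right side is 0 by the
    convention for division by zero. The integrals are therefore compared only almost
    everywhere.\<close>
  have eq: "sincsq t * cos (\<eta> * t) = (J (\<eta> + 2) t + J (\<eta> - 2) t - 2 * J \<eta> t) / 4" if "t \<noteq> 0" for t
  proof -
    have "cos (\<eta> * t + 2 * t) + cos (\<eta> * t - 2 * t) = 2 * cos (\<eta> * t) * cos (2 * t)"
      by (simp add: cos_add cos_diff)
    also have "\<dots> = 2 * cos (\<eta> * t) * (1 - 2 * (sin t)\<^sup>2)" by (simp add: cos_double_sin)
    finally have "cos ((\<eta> + 2) * t) + cos ((\<eta> - 2) * t) = 2 * cos (\<eta> * t) * (1 - 2 * (sin t)\<^sup>2)"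
      by (simp add: distrib_right left_diff_distrib)
    then have "(1 - cos ((\<eta> + 2) * t)) + (1 - cos ((\<eta> - 2) * t)) - 2 * (1 - cos (\<eta> * t)) =
        4 * ((sin t)\<^sup>2 * cos (\<eta> * t))"
      by (simp only: right_diff_distrib) (simp add: mult_ac)
    moreover have "J (\<eta> + 2) t + J (\<eta> - 2) t - 2 * J \<eta> t =
        ((1 - cos ((\<eta> + 2) * t)) + (1 - cos ((\<eta> - 2) * t)) - 2 * (1 - cos (\<eta> * t))) / t\<^sup>2"
      unfolding J_def by (simp add: diff_divide_distrib add_divide_distrib)
    ultimately show ?thesis using that by (simp add: sincsq_def power_divide)
  qed
  have "(LINT t|lborel. sincsq t * cos (\<eta> * t)) =
      (LINT t|lborel. (J (\<eta> + 2) t + J (\<eta> - 2) t - 2 * J \<eta> t) / 4)"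
    by (intro integral_cong_AE) (use AE_lborel_singleton[of 0] eq in auto)
  also have "\<dots> = ((LINT t|lborel. J (\<eta> + 2) t) + (LINT t|lborel. J (\<eta> - 2) t) - 2 * (LINT t|lborel. J \<eta> t)) / 4"
    by (simp add: iJ(1))
  also have "\<dots> = (\<bar>\<eta> + 2\<bar> + \<bar>\<eta> - 2\<bar> - 2 * \<bar>\<eta>\<bar>) * (LINT t|lborel. (1 - cos t) / t\<^sup>2) / 4"
    unfolding iJ(2) by (simp add: algebra_simps)
  also have "\<bar>\<eta> + 2\<bar> + \<bar>\<eta> - 2\<bar> - 2 * \<bar>\<eta>\<bar> = 0" using assms by linarith
  finally show ?thesis by simp
qed

lemma integral_sincsq_sin: "(LINT t|lborel. sincsq t * sin (\<eta> * t)) = 0"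
  using lborel_integral_real_affine[of "-1" "\<lambda>t. sincsq t * sin (\<eta> * t)" 0]
  by simp

text \<open>Dilation by \<open>r\<close> shrinks the support of the transform from [-2, 2] to
  [-2r, 2r].\<close>

lemma integral_sincsq_exp:
  assumes "0 < r" "2 * r \<le> \<bar>\<eta>\<bar>"
  shows "(LINT t|lborel. of_real (sincsq (r * t)) * exp (\<i> * of_real (\<eta> * t))) = (0 :: complex)"
proof -
  define \<theta> where "\<theta> = \<eta> / r"
  have \<theta>: "2 \<le> \<bar>\<theta>\<bar>" "\<eta> = r * \<theta>" using assms by (auto simp: \<theta>_def field_simps)
  have i: "integrable lborel (\<lambda>t. sincsq t * cos (\<theta> * t))" "integrable lborel (\<lambda>t. sincsq t * sin (\<theta> * t))"
    by (rule Bochner_Integration.integrable_bound[OF integrable_sincsq];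
        simp add: abs_mult sincsq_nonneg mult_left_le)+
  have "(LINT t|lborel. of_real (sincsq t) * exp (\<i> * of_real (\<theta> * t))) =
     (LINT t|lborel. complex_of_real (sincsq t * cos (\<theta> * t)) + \<i> * complex_of_real (sincsq t * sin (\<theta> * t)))"
    by (intro Bochner_Integration.integral_cong) (auto simp: exp_eq_polar cis_conv_exp[symmetric] complex_eq_iff)
  also have "\<dots> = complex_of_real (LINT t|lborel. sincsq t * cos (\<theta> * t)) +
      \<i> * complex_of_real (LINT t|lborel. sincsq t * sin (\<theta> * t))"
    using i[THEN integrable_of_real, where 'a=complex]
    by (subst Bochner_Integration.integral_add) (simp_all del: of_real_mult)
  also have "\<dots> = 0" using \<theta> by (simp add: integral_sincsq_cos integral_sincsq_sin)
  finally have "(LINT t|lborel. of_real (sincsq t) * exp (\<i> * of_real (\<theta> * t))) = (0 :: complex)" .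
  then show ?thesis
    using lborel_integral_real_affine[of r "\<lambda>t. of_real (sincsq t) * exp (\<i> * of_real (\<theta> * t)) :: complex" 0] assms
    by (simp add: \<theta>(2) mult_ac)
qed

section \<open>The product kernel and its spectrum\<close>

definition fejer :: "'a::euclidean_space \<Rightarrow> real" where
  "fejer x = (\<Prod>b\<in>Basis. sincsq (x \<bullet> b))"

lemma continuous_on_fejer: "continuous_on A fejer"
  unfolding fejer_def by (intro continuous_intros continuous_on_compose2[OF continuous_on_sincsq[of UNIV]]) auto

lemma borel_measurable_fejer [measurable]: "fejer \<in> borel_measurable borel"
  by (intro borel_measurable_continuous_onI continuous_on_fejer)

lemma fejer_nonneg: "0 \<le> fejer x"
  by (simp add: fejer_def prod_nonneg sincsq_nonneg)

lemma fejer_le_1: "fejer x \<le> 1"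
  by (simp add: fejer_def prod_le_1 sincsq_nonneg sincsq_le_1)

lemma integrable_fejer: "integrable lborel fejer"
  unfolding fejer_def by (intro integrable_lborel_prod integrable_sincsq)

lemma fejer_0: "fejer 0 = 1"
  by (simp add: fejer_def sincsq_def)

text \<open>A common integrable majorant, up to constants, for small translates of
  \<open>fejer\<close> and for Schwartz functions.\<close>

definition cauchy_prod :: "'a::euclidean_space \<Rightarrow> real" where
  "cauchy_prod x = (\<Prod>b\<in>Basis. inverse (1 + (x \<bullet> b)\<^sup>2))"

lemma integrable_cauchy_prod: "integrable lborel cauchy_prod"
  unfolding cauchy_prod_def by (intro integrable_lborel_prod integrable_inverse_1_plus_sq)

text \<open>A majorant uniform in the shift, for dominated convergence in
  \<open>fejer_modulus_tendsto\<close>. In each coordinate 6 = 2 * 3: the factor 2 is from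
  \<open>sincsq_le\<close>, the factor 3 from 1 + u^2 \<le> 3 (1 + (u - v)^2) for |v| \<le>
  1.\<close>

lemma fejer_diff_le:
  fixes x y :: "'a::euclidean_space"
  assumes "norm y \<le> 1"
  shows "fejer (x - y) \<le> 6 ^ DIM('a) * cauchy_prod x"
proof -
  have "fejer (x - y) \<le> (\<Prod>b\<in>Basis. 6 * inverse (1 + (x \<bullet> b)\<^sup>2))"
    unfolding fejer_def
  proof (intro prod_mono conjI sincsq_nonneg)
    fix b :: 'a assume b: "b \<in> Basis"
    define u v where "u = x \<bullet> b" and "v = y \<bullet> b"
    have "\<bar>v\<bar> \<le> 1" unfolding v_def using b Basis_le_norm[OF b, of y] assms by linarith
    then have "v\<^sup>2 \<le> 1" by (simp add: abs_square_le_1)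
    moreover have "u\<^sup>2 \<le> 2 * (u - v)\<^sup>2 + 2 * v\<^sup>2"
      using zero_le_power2[of "u - 2 * v"] by (simp add: power2_eq_square algebra_simps)
    ultimately have "1 + u\<^sup>2 \<le> 3 * (1 + (u - v)\<^sup>2)"
      using zero_le_power2[of "u - v"] by argo
    moreover have "0 < 1 + u\<^sup>2" "0 < 1 + (u - v)\<^sup>2" by (auto simp: add_pos_nonneg)
    ultimately have "2 * inverse (1 + (u - v)\<^sup>2) \<le> 6 * inverse (1 + u\<^sup>2)"
      by (simp add: divide_simps)
    then show "sincsq ((x - y) \<bullet> b) \<le> 6 * inverse (1 + (x \<bullet> b)\<^sup>2)"
      using sincsq_le[of "u - v"] by (simp add: u_def v_def inner_diff_left)
  qed
  then show ?thesis by (simp add: cauchy_prod_def prod.distrib)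
qed

text \<open>The spectrum lies in the cube of half-side 2r about \<xi>0: the transform is a product
  over the coordinates, and one vanishing factor suffices.\<close>

lemma fourier_modulated_fejer:
  fixes \<xi> \<xi>0 :: "'a::euclidean_space"
  assumes "0 < r" "b \<in> Basis" "2 * r \<le> \<bar>(\<xi> - \<xi>0) \<bullet> b\<bar>"
  shows "fourier (\<lambda>x. exp (\<i> * of_real (x \<bullet> \<xi>0)) * of_real (fejer (r *\<^sub>R x))) \<xi> = 0"
proof -
  define h :: "'a \<Rightarrow> real \<Rightarrow> complex"
    where "h c t = of_real (sincsq (r * t)) * exp (\<i> * of_real (((\<xi>0 - \<xi>) \<bullet> c) * t))" for c t
  have h: "integrable lborel (h c)" for c
  proof (rule Bochner_Integration.integrable_bound)
    show "integrable lborel (\<lambda>t. sincsq (r * t))"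
      using lborel_integrable_real_affine[OF integrable_sincsq, of r 0] assms by simp
    show "h c \<in> borel_measurable lborel" unfolding h_def by measurable
  qed (simp add: h_def norm_mult norm_exp_eq_Re)
  have eq: "exp (\<i> * of_real (x \<bullet> \<xi>0)) * of_real (fejer (r *\<^sub>R x)) * exp (- \<i> * of_real (x \<bullet> \<xi>)) =
      (\<Prod>c\<in>Basis. h c (x \<bullet> c))" for x
  proof -
    have "(\<Prod>c\<in>Basis. h c (x \<bullet> c)) = of_real (fejer (r *\<^sub>R x)) * exp (\<Sum>c\<in>Basis. \<i> * of_real (((\<xi>0 - \<xi>) \<bullet> c) * (x \<bullet> c)))"
      unfolding h_def prod.distrib by (simp add: exp_sum fejer_def)
    also have "(\<Sum>c\<in>Basis. \<i> * of_real (((\<xi>0 - \<xi>) \<bullet> c) * (x \<bullet> c))) =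
        \<i> * complex_of_real (\<Sum>c\<in>Basis. ((\<xi>0 - \<xi>) \<bullet> c) * (x \<bullet> c))"
      by (simp add: sum_distrib_left)
    also have "(\<Sum>c\<in>Basis. ((\<xi>0 - \<xi>) \<bullet> c) * (x \<bullet> c)) = x \<bullet> (\<xi>0 - \<xi>)"
      by (subst euclidean_inner) (simp add: mult.commute)
    finally show ?thesis
      by (simp add: inner_diff_right algebra_simps flip: exp_add)
  qed
  have "fourier (\<lambda>x. exp (\<i> * of_real (x \<bullet> \<xi>0)) * of_real (fejer (r *\<^sub>R x))) \<xi> =
      (\<Prod>c\<in>Basis. (LINT t|lborel. h c t))"
    unfolding fourier_def eq by (rule integral_lborel_prod[OF h])
  also have "(LINT t|lborel. h b t) = 0"
    unfolding h_def using assms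
    by (intro integral_sincsq_exp) (auto simp: inner_diff_left)
  with assms have "(\<Prod>c\<in>Basis. (LINT t|lborel. h c t)) = 0" by (intro prod_zero) auto
  finally show ?thesis .
qed

section \<open>Multipliers on integrable functions\<close>

lemma integrable_fourier_kernel:
  assumes "integrable lborel f"
  shows "integrable lborel (\<lambda>x. f x * exp (- \<i> * of_real (x \<bullet> \<xi>)))"
  by (rule Bochner_Integration.integrable_bound[OF assms])
    (use assms in \<open>auto simp: norm_mult\<close>)

lemma norm_fourier_le: "norm (fourier f \<xi>) \<le> (LINT x|lborel. norm (f x))"
  unfolding fourier_def by (rule order_trans[OF integral_norm_bound]) (simp add: norm_mult)

lemma borel_measurable_fourier [measurable]:
  fixes f :: "'a::euclidean_space \<Rightarrow> complex"
  assumes [measurable]: "f \<in> borel_measurable borel"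
  shows "fourier f \<in> borel_measurable borel"
proof -
  have "(\<lambda>\<xi>. LINT x|lborel. f x * exp (- \<i> * of_real (x \<bullet> \<xi>))) \<in> borel_measurable borel"
    by (rule lborel.borel_measurable_lebesgue_integral) measurable
  then show ?thesis by (simp add: fourier_def[abs_def])
qed

lemma integrable_mult_fourier:
  assumes f: "integrable lborel f" and h: "integrable lborel h"
  shows "integrable lborel (\<lambda>x. f x * fourier h x)"
proof (rule Bochner_Integration.integrable_bound)
  show "integrable lborel (\<lambda>x. f x * of_real (LINT x|lborel. norm (h x)))"
    using f by simp
  have [measurable]: "f \<in> borel_measurable borel" "h \<in> borel_measurable borel"
    using f h by auto
  show "(\<lambda>x. f x * fourier h x) \<in> borel_measurable lborel" by measurable
  show "AE x in lborel. norm (f x * fourier h x) \<le> norm (f x * of_real (LINT x|lborel. norm (h x)))"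
    by (intro AE_I2) (auto simp: norm_mult intro!: mult_left_mono order_trans[OF norm_fourier_le])
qed

text \<open>The multiplication formula, by Fubini. It links the distributional definition of
  \<open>fourier_multiplier\<close> to pointwise identities between transforms.\<close>

lemma integral_mult_fourier:
  fixes f h :: "'a::euclidean_space \<Rightarrow> complex"
  assumes f: "integrable lborel f" and h: "integrable lborel h"
  shows "(LINT x|lborel. f x * fourier h x) = (LINT \<xi>|lborel. fourier f \<xi> * h \<xi>)"
proof -
  have [measurable]: "f \<in> borel_measurable borel" "h \<in> borel_measurable borel"
    using f h by auto
  let ?k = "\<lambda>x \<xi>. f x * (h \<xi> * exp (- \<i> * of_real (\<xi> \<bullet> x)))"
  have int: "integrable (lborel \<Otimes>\<^sub>M lborel) (\<lambda>(x, \<xi>). ?k x \<xi>)"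
  proof (rule lborel_pair.Fubini_integrable)
    show "(\<lambda>(x, \<xi>). ?k x \<xi>) \<in> borel_measurable (lborel \<Otimes>\<^sub>M lborel)" by measurable
    show "integrable lborel (\<lambda>x. LINT \<xi>|lborel. norm (case (x, \<xi>) of (x, \<xi>) \<Rightarrow> ?k x \<xi>))"
      using f by (simp add: norm_mult)
    show "AE x in lborel. integrable lborel (\<lambda>\<xi>. case (x, \<xi>) of (x, \<xi>) \<Rightarrow> ?k x \<xi>)"
      using integrable_fourier_kernel[OF h] by simp
  qed
  have "(LINT x|lborel. f x * fourier h x) = (LINT x|lborel. (LINT \<xi>|lborel. ?k x \<xi>))"
    by (simp add: fourier_def)
  also have "\<dots> = (LINT \<xi>|lborel. (LINT x|lborel. ?k x \<xi>))"
    using lborel_pair.Fubini_integral[OF int] by simp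
  also have "\<dots> = (LINT \<xi>|lborel. (LINT x|lborel. h \<xi> * (f x * exp (- \<i> * of_real (x \<bullet> \<xi>)))))"
    by (simp add: inner_commute mult_ac)
  also have "\<dots> = (LINT \<xi>|lborel. fourier f \<xi> * h \<xi>)"
    by (simp add: fourier_def mult.commute)
  finally show ?thesis .
qed

text \<open>Decay of order \<open>2 * DIM('a)\<close> provides one factor (1 + |x|)^2 per
  coordinate, which dominates 1 + (x \<bullet> b)^2; hence \<open>cauchy_prod\<close> is a majorant
  up to a constant.\<close>

lemma schwartz_integrable:
  fixes \<psi> :: "'a::euclidean_space \<Rightarrow> complex"
  assumes "schwartz \<psi>"
  shows "integrable lborel \<psi>"
proof -
  have diff: "\<psi> differentiable (at x)" for x
    using assms unfolding schwartz_def by (metis empty_subsetI list.set(1) partial_derivs.simps(1))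
  then have "continuous_on UNIV \<psi>"
    by (simp add: continuous_at_imp_continuous_on differentiable_imp_continuous_within)
  then have [measurable]: "\<psi> \<in> borel_measurable borel" by (rule borel_measurable_continuous_onI)
  have "bounded (range (\<lambda>x. of_real ((1 + norm x) ^ (2 * DIM('a))) * \<psi> x))"
    using assms unfolding schwartz_def by (metis empty_subsetI list.set(1) partial_derivs.simps(1))
  then obtain B where B: "\<And>x. norm (of_real ((1 + norm x) ^ (2 * DIM('a))) * \<psi> x) \<le> B"
    unfolding bounded_iff by blast
  show ?thesis
  proof (rule Bochner_Integration.integrable_bound)
    show "integrable lborel (\<lambda>x::'a. B * cauchy_prod x)"
      by (intro integrable_mult_right integrable_cauchy_prod)
    show "AE x in lborel. norm (\<psi> x) \<le> norm (B * cauchy_prod x)"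
    proof (rule AE_I2)
      fix x :: 'a
      have "(\<Prod>b\<in>(Basis::'a set). 1 + (x \<bullet> b)\<^sup>2) \<le> (\<Prod>b\<in>(Basis::'a set). (1 + norm x)\<^sup>2)"
      proof (intro prod_mono conjI)
        fix b :: 'a assume "b \<in> Basis"
        then have "(x \<bullet> b)\<^sup>2 \<le> (norm x)\<^sup>2" by (metis Basis_le_norm abs_le_square_iff abs_norm_cancel)
        moreover have "(1 + norm x)\<^sup>2 = 1 + (2 * norm x + (norm x)\<^sup>2)" by (simp add: power2_sum)
        ultimately show "1 + (x \<bullet> b)\<^sup>2 \<le> (1 + norm x)\<^sup>2"
          by (simp add: add_increasing)
      qed simp
      also have "\<dots> = (1 + norm x) ^ (2 * DIM('a))" by (simp add: power_mult)
      finally have le: "(\<Prod>b\<in>(Basis::'a set). 1 + (x \<bullet> b)\<^sup>2) \<le> (1 + norm x) ^ (2 * DIM('a))" .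
      have "0 < 1 + (x \<bullet> b)\<^sup>2" for b by (simp add: add_pos_nonneg)
      then have pos: "0 < (\<Prod>b\<in>(Basis::'a set). 1 + (x \<bullet> b)\<^sup>2)" by (intro prod_pos) auto
      have "norm (\<psi> x) * (\<Prod>b\<in>(Basis::'a set). 1 + (x \<bullet> b)\<^sup>2) \<le> (1 + norm x) ^ (2 * DIM('a)) * norm (\<psi> x)"
        using le by (subst mult.commute) (intro mult_right_mono norm_ge_zero)
      also have "\<dots> \<le> B" using B[of x] by (simp add: norm_mult abs_of_nonneg del: of_real_power of_real_add)
      finally have "norm (\<psi> x) \<le> B / (\<Prod>b\<in>(Basis::'a set). 1 + (x \<bullet> b)\<^sup>2)"
        using pos by (simp add: pos_le_divide_eq)
      also have "\<dots> = B * cauchy_prod x"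
        by (simp add: cauchy_prod_def prod_dividef divide_inverse flip: prod_inversef)
      finally show "norm (\<psi> x) \<le> norm (B * cauchy_prod x)" by simp
    qed
  qed simp
qed

text \<open>The multiplication formula, applied to \<open>g\<close> with \<psi> and to
  \<open>f\<close> with the product of \<open>m\<close> and \<psi>, turns the pointwise identity
  into the distributional one.\<close>

lemma fourier_multiplierI:
  fixes f g m :: "'a::euclidean_space \<Rightarrow> complex"
  assumes f: "integrable lborel f" and g: "integrable lborel g"
    and m: "m \<in> borel_measurable borel" "\<And>\<xi>. norm (m \<xi>) \<le> B"
    and eq: "\<And>\<xi>. fourier g \<xi> = m \<xi> * fourier f \<xi>"
  shows "fourier_multiplier m f g"
  unfolding fourier_multiplier_def
proof (intro conjI allI impI)
  show "f \<in> borel_measurable lborel" "g \<in> borel_measurable lborel" using f g by auto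
  fix \<psi> :: "'a \<Rightarrow> complex" assume "schwartz \<psi>"
  then have \<psi>: "integrable lborel \<psi>" by (rule schwartz_integrable)
  have m\<psi>: "integrable lborel (\<lambda>\<xi>. m \<xi> * \<psi> \<xi>)"
  proof (rule Bochner_Integration.integrable_bound)
    show "integrable lborel (\<lambda>\<xi>. of_real B * \<psi> \<xi>)" using \<psi> by simp
    show "AE \<xi> in lborel. norm (m \<xi> * \<psi> \<xi>) \<le> norm (of_real B * \<psi> \<xi>)"
      using m(2) order_trans[OF m(2) abs_ge_self] by (intro AE_I2) (simp add: norm_mult mult_right_mono)
  qed (use \<psi> m in measurable)
  show "integrable lborel (\<lambda>x. f x * fourier \<psi> x)" "integrable lborel (\<lambda>x. g x * fourier \<psi> x)"
    "integrable lborel (\<lambda>x. f x * fourier (\<lambda>\<xi>. m \<xi> * \<psi> \<xi>) x)"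
    by (intro integrable_mult_fourier f g \<psi> m\<psi>)+
  show "(LINT x|lborel. g x * fourier \<psi> x) = (LINT x|lborel. f x * fourier (\<lambda>\<xi>. m \<xi> * \<psi> \<xi>) x)"
    unfolding integral_mult_fourier[OF g \<psi>] integral_mult_fourier[OF f m\<psi>] eq by (simp add: mult_ac)
qed

section \<open>Translations and dilations\<close>

lemma lborel_integral_scaleR:
  fixes F :: "'a::euclidean_space \<Rightarrow> 'b::{banach,second_countable_topology}"
  assumes F: "integrable lborel F" and r: "0 < r"
  shows "integrable lborel (\<lambda>x. F (r *\<^sub>R x))"
    and "(LINT x|lborel. F (r *\<^sub>R x)) = (1 / r ^ DIM('a)) *\<^sub>R (LINT x|lborel. F x)"
proof -
  have [measurable]: "F \<in> borel_measurable borel" using F by auto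
  have eq: "lborel = density (distr lborel borel (\<lambda>x. r *\<^sub>R x)) (\<lambda>_::'a. ennreal (r ^ DIM('a)))"
    using lborel_affine[of r 0] r by simp
  have "integrable lborel (\<lambda>x. r ^ DIM('a) *\<^sub>R F (r *\<^sub>R x))"
    using F r by (subst (asm) eq) (simp add: integrable_density integrable_distr_eq)
  from integrable_scaleR_right[OF this, of "1 / r ^ DIM('a)"] r
  show "integrable lborel (\<lambda>x. F (r *\<^sub>R x))" by simp
  have "(LINT x|lborel. F x) = r ^ DIM('a) *\<^sub>R (LINT x|lborel. F (r *\<^sub>R x))"
    using r by (subst eq) (simp add: integral_density integral_distr)
  then show "(LINT x|lborel. F (r *\<^sub>R x)) = (1 / r ^ DIM('a)) *\<^sub>R (LINT x|lborel. F x)"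
    using r by simp
qed

lemma lborel_integral_translate:
  fixes F :: "'a::euclidean_space \<Rightarrow> 'b::{banach,second_countable_topology}"
  assumes F: "integrable lborel F"
  shows "integrable lborel (\<lambda>x. F (x - y))"
    and "(LINT x|lborel. F (x - y)) = (LINT x|lborel. F x)"
proof -
  have [measurable]: "F \<in> borel_measurable borel" using F by auto
  have eq: "lborel = distr lborel borel (\<lambda>x. - y + x)"
    by (rule lborel_distr_plus[symmetric])
  show "integrable lborel (\<lambda>x. F (x - y))"
    using F by (subst (asm) eq) (simp add: integrable_distr_eq)
  show "(LINT x|lborel. F (x - y)) = (LINT x|lborel. F x)"
    by (subst (2) eq) (simp add: integral_distr)
qed

lemma fourier_translate:
  assumes f: "integrable lborel f"
  shows "fourier (\<lambda>x. f (x - y)) \<xi> = character y \<xi> * fourier f \<xi>"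
proof -
  have "fourier (\<lambda>x. f (x - y)) \<xi> =
      (LINT x|lborel. character y \<xi> * (f (x - y) * exp (- \<i> * of_real ((x - y) \<bullet> \<xi>))))"
    unfolding fourier_def
    by (intro Bochner_Integration.integral_cong) (simp_all add: inner_diff_left algebra_simps flip: exp_add)
  also have "\<dots> = character y \<xi> * (LINT x|lborel. f (x - y) * exp (- \<i> * of_real ((x - y) \<bullet> \<xi>)))"
    by simp
  also have "(LINT x|lborel. f (x - y) * exp (- \<i> * of_real ((x - y) \<bullet> \<xi>))) = fourier f \<xi>"
    unfolding fourier_def
    by (rule lborel_integral_translate(2)[OF integrable_fourier_kernel[OF f], where y = y])
  finally show ?thesis .
qed

text \<open>Boundedness of \<open>f\<close> makes the series converge at every point, and
  integrability makes it converge in L^1, so the transform may be taken term by term.\<close>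

lemma
  fixes f :: "'a::euclidean_space \<Rightarrow> complex" and a :: "nat \<Rightarrow> complex" and y :: "nat \<Rightarrow> 'a"
  assumes f: "integrable lborel f" "\<And>x. norm (f x) \<le> B"
    and a: "summable (\<lambda>k. norm (a k))"
  shows integrable_translates: "integrable lborel (\<lambda>x. \<Sum>k. a k * f (x - y k))" (is ?I)
    and fourier_translates:
      "fourier (\<lambda>x. \<Sum>k. a k * f (x - y k)) \<xi> = (\<Sum>k. a k * character (y k) \<xi>) * fourier f \<xi>" (is ?F)
proof -
  note tr = lborel_integral_translate[OF f(1)]
  have int: "integrable lborel (\<lambda>x. a k * f (x - y k))" for k
    using tr(1) by simp
  have smx: "summable (\<lambda>k. norm (a k * f (x - y k)))" for x
  proof (rule summable_comparison_test[OF _ summable_mult2[OF a, of B]], intro exI allI impI)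
    show "norm (norm (a k * f (x - y k))) \<le> norm (a k) * B" for k
      using f(2) by (simp add: norm_mult mult_left_mono)
  qed
  have "(LINT x|lborel. norm (a k * f (x - y k))) = norm (a k) * (LINT x|lborel. norm (f x))" for k
    using lborel_integral_translate(2)[OF integrable_norm[OF f(1)], of "y k"] by (simp add: norm_mult)
  then have smi: "summable (\<lambda>k. LINT x|lborel. norm (a k * f (x - y k)))"
    using summable_mult2[OF a] by simp
  show ?I by (rule integrable_suminf[OF int _ smi]) (use smx in auto)
  have eq: "(\<Sum>k. a k * f (x - y k)) * exp (- \<i> * of_real (x \<bullet> \<xi>)) =
      (\<Sum>k. a k * f (x - y k) * exp (- \<i> * of_real (x \<bullet> \<xi>)))" for x
    by (rule suminf_mult2[OF summable_norm_cancel[OF smx]])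
  have "fourier (\<lambda>x. \<Sum>k. a k * f (x - y k)) \<xi> =
      (\<Sum>k. LINT x|lborel. a k * f (x - y k) * exp (- \<i> * of_real (x \<bullet> \<xi>)))"
    unfolding fourier_def eq
  proof (rule integral_suminf)
    show "integrable lborel (\<lambda>x. a k * f (x - y k) * exp (- \<i> * of_real (x \<bullet> \<xi>)))" for k
      by (rule integrable_fourier_kernel[OF int])
    show "AE x in lborel. summable (\<lambda>k. norm (a k * f (x - y k) * exp (- \<i> * of_real (x \<bullet> \<xi>))))"
      using smx by (simp add: norm_mult)
    show "summable (\<lambda>k. LINT x|lborel. norm (a k * f (x - y k) * exp (- \<i> * of_real (x \<bullet> \<xi>))))"
      using smi by (simp add: norm_mult)
  qed
  also have "\<dots> = (\<Sum>k. a k * character (y k) \<xi> * fourier f \<xi>)"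
  proof (rule suminf_cong)
    fix k
    have "(LINT x|lborel. a k * f (x - y k) * exp (- \<i> * of_real (x \<bullet> \<xi>))) =
        a k * fourier (\<lambda>x. f (x - y k)) \<xi>"
      by (simp add: fourier_def mult.assoc)
    then show "(LINT x|lborel. a k * f (x - y k) * exp (- \<i> * of_real (x \<bullet> \<xi>))) =
        a k * character (y k) \<xi> * fourier f \<xi>"
      using fourier_translate[OF f(1)] by simp
  qed
  also have "\<dots> = (\<Sum>k. a k * character (y k) \<xi>) * fourier f \<xi>"
    by (rule suminf_mult2[symmetric], rule summable_norm_cancel) (use a in \<open>simp add: norm_mult\<close>)
  finally show ?F .
qed

section \<open>Size and L^1 continuity of the kernel\<close>

text \<open>Integrability follows from 0 \<le> \<open>fejer\<close> \<le> 1. If the integral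
  vanished, the nonempty open set where the continuous kernel is nonzero would be
  negligible.\<close>

lemma integral_fejer_powr_pos:
  assumes p: "1 \<le> p"
  shows "integrable lborel (\<lambda>x::'a::euclidean_space. fejer x powr p)"
    and "0 < (LINT x|lborel. fejer (x :: 'a) powr p)"
proof -
  have "fejer x powr p \<le> fejer x powr 1" for x :: 'a
    using p by (intro powr_mono' fejer_nonneg fejer_le_1)
  then show int: "integrable lborel (\<lambda>x::'a. fejer x powr p)"
    by (intro Bochner_Integration.integrable_bound[OF integrable_fejer]) (auto simp: fejer_nonneg)
  have "(LINT x|lborel. fejer (x :: 'a) powr p) \<noteq> 0"
  proof
    assume "(LINT x|lborel. fejer (x :: 'a) powr p) = 0"
    then have "AE x in lborel. fejer (x :: 'a) powr p = 0"
      using integral_nonneg_eq_0_iff_AE[OF int] by simp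
    then have "AE x in lborel. x \<notin> {x::'a. fejer x \<noteq> 0}" by simp
    then have "negligible {x::'a. fejer x \<noteq> 0}"
      unfolding negligible_iff_null_sets
      by (intro null_sets_completionI) (subst AE_iff_null_sets, auto)
    moreover have "open {x::'a. fejer x \<noteq> 0}"
      by (intro open_Collect_neq continuous_on_fejer continuous_on_const)
    moreover have "(0::'a) \<in> {x. fejer x \<noteq> 0}" by (simp add: fejer_0)
    ultimately show False using open_not_negligible by blast
  qed
  moreover have "0 \<le> (LINT x|lborel. fejer (x :: 'a) powr p)" by simp
  ultimately show "0 < (LINT x|lborel. fejer (x :: 'a) powr p)" by linarith
qed

text \<open>The L^1 modulus of continuity of the kernel.\<close>

definition fejer_modulus :: "'a::euclidean_space \<Rightarrow> real" where
  "fejer_modulus y = (LINT x|lborel. \<bar>fejer x - fejer (x - y)\<bar>)"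

lemma integrable_fejer_diff:
  "integrable lborel (\<lambda>x::'a::euclidean_space. \<bar>fejer x - fejer (x - y)\<bar>)"
  by (intro integrable_abs Bochner_Integration.integrable_diff integrable_fejer
      lborel_integral_translate(1)[OF integrable_fejer])

text \<open>This bound is uniform in \<open>y\<close> and serves as the majorant when a limit is
  taken under a sum over all translations.\<close>

lemma fejer_modulus_le:
  fixes y :: "'a::euclidean_space"
  shows "fejer_modulus y \<le> 2 * (LINT x|lborel. fejer (x :: 'a))"
proof -
  have "fejer_modulus y \<le> (LINT x|lborel. fejer x + fejer (x - y))"
    unfolding fejer_modulus_def
  proof (rule integral_mono[OF integrable_fejer_diff])
    show "integrable lborel (\<lambda>x. fejer x + fejer (x - y))"
      by (intro Bochner_Integration.integrable_add integrable_fejer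
        lborel_integral_translate(1)[OF integrable_fejer])
    show "\<bar>fejer x - fejer (x - y)\<bar> \<le> fejer x + fejer (x - y)" for x
      using fejer_nonneg[of x] fejer_nonneg[of "x - y"] by linarith
  qed
  also have "\<dots> = 2 * (LINT x|lborel. fejer (x :: 'a))"
    using lborel_integral_translate[OF integrable_fejer, of y] integrable_fejer[where 'a='a] by simp
  finally show ?thesis .
qed

lemma fejer_modulus_nonneg: "0 \<le> fejer_modulus y"
  by (simp add: fejer_modulus_def)

lemma fejer_modulus_tendsto:
  fixes Y :: "nat \<Rightarrow> 'a::euclidean_space"
  assumes "Y \<longlonglongrightarrow> 0"
  shows "(\<lambda>n. fejer_modulus (Y n)) \<longlonglongrightarrow> 0"
proof -
  have "eventually (\<lambda>n. norm (Y n) < 1) sequentially"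
    using order_tendstoD(2)[OF tendsto_norm[OF assms], of 1] by simp
  then obtain N where N: "\<And>n. N \<le> n \<Longrightarrow> norm (Y n) \<le> 1"
    unfolding eventually_sequentially by (meson less_imp_le)
  \<comment> \<open>The shift by \<open>N\<close> makes every translation vector at most 1 in norm,
    as the majorant requires.\<close>
  have "(\<lambda>n. fejer_modulus (Y (n + N))) \<longlonglongrightarrow> integral\<^sup>L (lborel :: 'a measure) (\<lambda>_. 0)"
    unfolding fejer_modulus_def
  proof (rule integral_dominated_convergence)
    show "integrable lborel (\<lambda>x::'a. fejer x + 6 ^ DIM('a) * cauchy_prod x)"
      by (intro Bochner_Integration.integrable_add integrable_mult_right integrable_fejer integrable_cauchy_prod)
    show "AE x in lborel. (\<lambda>n. \<bar>fejer x - fejer (x - Y (n + N))\<bar>) \<longlonglongrightarrow> (0::real)"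
    proof (rule AE_I2)
      fix x :: 'a
      have "isCont fejer x" using continuous_on_fejer[of "UNIV :: 'a set"] by (simp add: continuous_on_eq_continuous_at)
      moreover have "(\<lambda>n. x - Y (n + N)) \<longlonglongrightarrow> x - 0"
        by (intro tendsto_intros LIMSEQ_ignore_initial_segment assms)
      ultimately have "(\<lambda>n. fejer (x - Y (n + N))) \<longlonglongrightarrow> fejer x"
        using isCont_tendsto_compose[of x fejer] by simp
      then have "(\<lambda>n. \<bar>fejer x - fejer (x - Y (n + N))\<bar>) \<longlonglongrightarrow> \<bar>fejer x - fejer x\<bar>"
        by (intro tendsto_intros)
      then show "(\<lambda>n. \<bar>fejer x - fejer (x - Y (n + N))\<bar>) \<longlonglongrightarrow> (0::real)" by simp
    qed
    show "AE x in lborel. norm \<bar>fejer x - fejer (x - Y (n + N))\<bar> \<le> fejer x + 6 ^ DIM('a) * cauchy_prod x" for n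
    proof (rule AE_I2)
      fix x :: 'a
      show "norm \<bar>fejer x - fejer (x - Y (n + N))\<bar> \<le> fejer x + 6 ^ DIM('a) * cauchy_prod x"
        using fejer_diff_le[OF N[of "n + N"], of x] fejer_nonneg[of x] fejer_nonneg[of "x - Y (n + N)"]
        by simp
    qed
  qed simp_all
  then show ?thesis by (simp add: LIMSEQ_offset)
qed

section \<open>Approximate eigenfunctions\<close>

lemma Lp_normI:
  assumes "f \<in> borel_measurable borel" "integrable lborel (\<lambda>x. norm (f x) powr p)"
  shows "Lp_norm p f = ennreal ((LINT x|lborel. norm (f x) powr p) powr (1 / p))"
  using assms by (simp add: Lp_norm_def Lp_def)

text \<open>The multiplier acts on the test function \<open>f\<close> as the superposition
  \<open>g\<close> of translates. The pointwise error is at most \<open>c * V x\<close> with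
  \<open>V x \<le> A\<close>, and V^p \<le> A^(p-1) V reduces the L^p estimate to an L^1 estimate
  that is uniform over all translations.\<close>

lemma approximate_eigenfunction:
  fixes m M :: "'a::euclidean_space \<Rightarrow> complex" and \<xi>0 :: 'a
  assumes M: "trig_series C M" and \<epsilon>: "0 < \<epsilon>"
    and loc: "\<And>\<xi>. (\<And>b. b \<in> Basis \<Longrightarrow> \<bar>(\<xi> - \<xi>0) \<bullet> b\<bar> \<le> \<epsilon>) \<Longrightarrow> m \<xi> = M \<xi>"
    and m: "m \<in> borel_measurable borel" "\<And>\<xi>. norm (m \<xi>) \<le> B"
    and p: "1 \<le> p" and e: "0 < e"
  obtains f g where "Lp_norm p f = 1" "fourier_multiplier m f g"
    "Lp_norm p (\<lambda>x. M \<xi>0 * f x - g x) \<le> ennreal e"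
proof -
  obtain a and y :: "nat \<Rightarrow> 'a" where a: "summable (\<lambda>k. norm (a k))"
    and M_eq: "\<And>\<xi>. M \<xi> = (\<Sum>k. a k * character (y k) \<xi>)"
    using M unfolding trig_series_def by blast
  define A where "A = 1 + (\<Sum>k. norm (a k))"
  have A: "1 \<le> A" "(\<Sum>k. norm (a k)) \<le> A" using a by (simp_all add: A_def suminf_nonneg)
  define I where "I = (LINT x|lborel. fejer (x :: 'a) powr p)"
  have I: "0 < I" unfolding I_def by (rule integral_fejer_powr_pos[OF p])
  \<comment> \<open>Up to the Jacobian \<open>r ^ DIM('a)\<close> this will be the integral of the
    error function \<open>V\<close>.\<close>
  define W where "W r = (\<Sum>k. norm (a k) * fejer_modulus (r *\<^sub>R y k))" for r
  have sW: "summable (\<lambda>k. norm (a k) * fejer_modulus (r *\<^sub>R y k))" for r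
  proof (rule summable_comparison_test[OF _ summable_mult2[OF a]], intro exI allI impI)
    show "norm (norm (a k) * fejer_modulus (r *\<^sub>R y k)) \<le> norm (a k) * (2 * (LINT x|lborel. fejer (x :: 'a)))" for k
      using fejer_modulus_le[of "r *\<^sub>R y k"] fejer_modulus_nonneg[of "r *\<^sub>R y k"]
      by (simp add: mult_left_mono)
  qed
  \<comment> \<open>Tannery's theorem: each term tends to 0 because its shift does, and
    \<open>fejer_modulus_le\<close> gives a summable majorant.\<close>
  have "(\<lambda>n. W (inverse (real (Suc n)))) \<longlonglongrightarrow> (\<Sum>k. norm (a k) * 0)"
    unfolding W_def
  proof (intro tannerys_theorem[THEN conjunct2, THEN conjunct2])
    show "summable (\<lambda>k. norm (a k) * (2 * (LINT x|lborel. fejer (x :: 'a))))"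
      by (rule summable_mult2[OF a])
    show "\<forall>\<^sub>F (k, n) in at_top \<times>\<^sub>F sequentially.
        norm (norm (a k) * fejer_modulus (inverse (real (Suc n)) *\<^sub>R y k)) \<le> norm (a k) * (2 * (LINT x|lborel. fejer (x :: 'a)))"
      by (intro always_eventually)
        (auto intro!: mult_left_mono fejer_modulus_le simp: abs_mult abs_of_nonneg[OF fejer_modulus_nonneg])
    show "(\<lambda>n. norm (a k) * fejer_modulus (inverse (real (Suc n)) *\<^sub>R y k)) \<longlonglongrightarrow> norm (a k) * 0" for k
      using tendsto_scaleR[OF LIMSEQ_inverse_real_of_nat tendsto_const[of "y k"]]
      by (intro tendsto_mult tendsto_const fejer_modulus_tendsto) simp
  qed simp
  then have lim: "(\<lambda>n. A powr (p - 1) * W (inverse (real (Suc n))) / I) \<longlonglongrightarrow> A powr (p - 1) * 0 / I"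
    using I by (intro tendsto_intros) auto
  have "0 < e powr p" using e by simp
  then have "\<forall>\<^sub>F n in sequentially. A powr (p - 1) * W (inverse (real (Suc n))) / I < e powr p"
    using order_tendstoD(2)[OF lim] by simp
  moreover have "\<forall>\<^sub>F n in sequentially. inverse (real (Suc n)) < \<epsilon> / 2"
    using order_tendstoD(2)[OF LIMSEQ_inverse_real_of_nat, of "\<epsilon> / 2"] \<epsilon> by simp
  ultimately have "\<forall>\<^sub>F n in sequentially. A powr (p - 1) * W (inverse (real (Suc n))) / I < e powr p \<and>
      inverse (real (Suc n)) < \<epsilon> / 2"
    by (rule eventually_conj)
  \<comment> \<open>The first condition makes the L^p error small, the second keeps the spectrum of
    \<open>f\<close> in the box where \<open>m\<close> and \<open>M\<close> agree.\<close>
  then obtain n where n: "A powr (p - 1) * W (inverse (real (Suc n))) / I < e powr p"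
      "inverse (real (Suc n)) < \<epsilon> / 2"
    unfolding eventually_sequentially by blast
  define r where "r = inverse (real (Suc n))"
  have r: "0 < r" "2 * r < \<epsilon>" and small: "A powr (p - 1) * W r / I < e powr p"
    using n by (simp_all add: r_def)
  define \<phi> where "\<phi> x = fejer (r *\<^sub>R x)" for x :: 'a
  have \<phi>_meas [measurable]: "\<phi> \<in> borel_measurable borel" unfolding \<phi>_def by measurable
  \<comment> \<open>Normalises \<open>f\<close> in L^p, since the p-th power of \<phi> has integral
    I / r^d with d = \<open>DIM('a)\<close>.\<close>
  define c where "c = (I / r ^ DIM('a)) powr (- 1 / p)"
  have "c powr p = (I / r ^ DIM('a)) powr (- 1)"
    unfolding c_def powr_powr using p by simp
  then have c: "0 < c" "c powr p = r ^ DIM('a) / I"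
    using I r by (simp_all add: c_def powr_minus)
  define f where "f x = of_real c * (exp (\<i> * of_real (x \<bullet> \<xi>0)) * of_real (\<phi> x))" for x
  define g where "g x = (\<Sum>k. a k * f (x - y k))" for x
  have f_meas [measurable]: "f \<in> borel_measurable borel" unfolding f_def by measurable
  have norm_f: "norm (f x) = c * \<phi> x" for x
    using c(1) fejer_nonneg[of "r *\<^sub>R x"] by (simp add: f_def norm_mult \<phi>_def)
  have int_\<phi>: "integrable lborel \<phi>"
    unfolding \<phi>_def by (rule lborel_integral_scaleR[OF integrable_fejer r(1)])
  have f: "integrable lborel f"
    by (rule Bochner_Integration.integrable_bound[OF integrable_mult_right[OF int_\<phi>, of c]])
      (auto simp: norm_f)
  have f_bound: "norm (f x) \<le> c" for x
    using c fejer_le_1 by (simp add: norm_f \<phi>_def mult_left_le)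
  have g: "integrable lborel g"
    unfolding g_def by (rule integrable_translates[OF f f_bound a])
  then have g_meas [measurable]: "g \<in> borel_measurable borel" by auto
  have mult: "fourier_multiplier m f g"
  proof (rule fourier_multiplierI[OF f g m])
    fix \<xi>
    have fg: "fourier g \<xi> = M \<xi> * fourier f \<xi>"
      unfolding g_def M_eq by (rule fourier_translates[OF f f_bound a])
    show "fourier g \<xi> = m \<xi> * fourier f \<xi>"
    \<comment> \<open>Inside the box the two symbols agree; outside it the transform of
      \<open>f\<close> vanishes.\<close>
    proof (cases "\<forall>b\<in>Basis. \<bar>(\<xi> - \<xi>0) \<bullet> b\<bar> \<le> \<epsilon>")
      case True
      then show ?thesis using fg loc[of \<xi>] by simp
    next
      case False
      then obtain b where b: "b \<in> Basis" "2 * r \<le> \<bar>(\<xi> - \<xi>0) \<bullet> b\<bar>" using r by force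
      have "fourier f \<xi> = of_real c * fourier (\<lambda>x. exp (\<i> * of_real (x \<bullet> \<xi>0)) * of_real (fejer (r *\<^sub>R x))) \<xi>"
        by (simp add: fourier_def f_def \<phi>_def mult.assoc)
      also have "\<dots> = 0" using fourier_modulated_fejer[OF r(1) b] by simp
      finally show ?thesis using fg by simp
    qed
  qed
  have "(LINT x|lborel. norm (f x) powr p) = c powr p * (LINT x|lborel. fejer (r *\<^sub>R x :: 'a) powr p)"
    using c fejer_nonneg by (simp add: norm_f \<phi>_def powr_mult)
  also have "(LINT x|lborel. fejer (r *\<^sub>R x :: 'a) powr p) = I / r ^ DIM('a)"
    unfolding I_def using lborel_integral_scaleR(2)[OF integral_fejer_powr_pos(1)[OF p] r(1)] by simp
  finally have int_f: "(LINT x|lborel. norm (f x) powr p) = 1" using c I r by simp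
  \<comment> \<open>A non-integrable function has integral 0 by convention, so the value 1 proves
    integrability.\<close>
  moreover have "integrable lborel (\<lambda>x. norm (f x) powr p)"
    using int_f not_integrable_integral_eq by fastforce
  ultimately have norm1: "Lp_norm p f = 1" by (subst Lp_normI) auto
  define V where "V x = (\<Sum>k. norm (a k) * \<bar>\<phi> x - \<phi> (x - y k)\<bar>)" for x
  have \<phi>_diff: "\<bar>\<phi> x - \<phi> z\<bar> \<le> 1" for x z
    using fejer_nonneg[of "r *\<^sub>R x"] fejer_le_1[of "r *\<^sub>R x"] fejer_nonneg[of "r *\<^sub>R z"] fejer_le_1[of "r *\<^sub>R z"]
    unfolding \<phi>_def by linarith
  have sV: "summable (\<lambda>k. norm (a k) * \<bar>\<phi> x - \<phi> (x - y k)\<bar>)" for x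
    by (rule summable_comparison_test[OF _ a]) (use \<phi>_diff in \<open>auto simp: abs_mult mult_left_le\<close>)
  have V0: "0 \<le> V x" for x unfolding V_def by (intro suminf_nonneg sV) auto
  have "V x \<le> (\<Sum>k. norm (a k))" for x
    unfolding V_def by (intro suminf_le sV a) (use \<phi>_diff in \<open>auto simp: mult_left_le\<close>)
  then have VA: "V x \<le> A" for x using A order_trans by blast
  have dV: "norm (M \<xi>0 * f x - g x) \<le> c * V x" for x
  proof -
    have s1: "summable (\<lambda>k. a k * character (y k) \<xi>0)"
      by (rule summable_norm_cancel) (use a in \<open>simp add: norm_mult\<close>)
    have s2: "summable (\<lambda>k. a k * f (x - y k))"
    proof (rule summable_norm_cancel, rule summable_comparison_test[OF _ summable_mult2[OF a, of c]],
        intro exI allI impI)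
      show "norm (norm (a k * f (x - y k))) \<le> norm (a k) * c" for k
        using f_bound by (simp add: norm_mult mult_left_mono)
    qed
    \<comment> \<open>Translation by \<open>y k\<close> changes the phase of \<open>f\<close> by
      exactly \<open>character (y k) \<xi>0\<close>, so after factoring out phases only the
      difference of the real profiles remains.\<close>
    have term_eq: "norm (a k * character (y k) \<xi>0 * f x - a k * f (x - y k)) = c * (norm (a k) * \<bar>\<phi> x - \<phi> (x - y k)\<bar>)" for k
    proof -
      define u v where "u = exp (\<i> * complex_of_real (x \<bullet> \<xi>0))" and "v = character (y k) \<xi>0"
      have "exp (\<i> * complex_of_real ((x - y k) \<bullet> \<xi>0)) = v * u"
        unfolding u_def v_def by (simp add: inner_diff_left algebra_simps flip: exp_add)
      then have "a k * v * f x - a k * f (x - y k) = of_real c * (a k * (v * u)) * of_real (\<phi> x - \<phi> (x - y k))"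
        by (simp add: f_def algebra_simps flip: u_def)
      moreover have "norm u = 1" "norm v = 1" by (simp_all add: u_def v_def)
      ultimately show ?thesis
        unfolding v_def[symmetric] using c(1) by (simp add: norm_mult del: of_real_diff)
    qed
    have "M \<xi>0 * f x = (\<Sum>k. a k * character (y k) \<xi>0 * f x)"
      by (subst M_eq) (rule suminf_mult2[OF s1])
    then have "M \<xi>0 * f x - g x = (\<Sum>k. a k * character (y k) \<xi>0 * f x - a k * f (x - y k))"
      by (simp only: g_def suminf_diff[OF summable_mult2[OF s1, of "f x"] s2])
    also have "norm \<dots> \<le> (\<Sum>k. norm (a k * character (y k) \<xi>0 * f x - a k * f (x - y k)))"
      by (rule summable_norm) (unfold term_eq, rule summable_mult[OF sV])
    also have "\<dots> = c * V x" unfolding term_eq V_def by (rule suminf_mult[OF sV])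
    finally show ?thesis .
  qed
  have int_diff: "integrable lborel (\<lambda>x. \<bar>\<phi> x - \<phi> (x - z)\<bar>)"
    "(LINT x|lborel. \<bar>\<phi> x - \<phi> (x - z)\<bar>) = fejer_modulus (r *\<^sub>R z) / r ^ DIM('a)" for z
    unfolding \<phi>_def fejer_modulus_def scaleR_diff_right
    using lborel_integral_scaleR[OF integrable_fejer_diff[of "r *\<^sub>R z"] r(1)]
    by (simp_all only: real_scaleR_def times_divide_eq_left mult_1_left)
  have sint: "summable (\<lambda>k. LINT x|lborel. norm (norm (a k) * \<bar>\<phi> x - \<phi> (x - y k)\<bar>))"
    using summable_divide[OF sW[of r], of "r ^ DIM('a)"] by (simp add: int_diff)
  have AEV: "AE x in lborel. summable (\<lambda>k. norm (norm (a k) * \<bar>\<phi> x - \<phi> (x - y k)\<bar>))"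
    using sV by (simp add: abs_mult)
  have V: "integrable lborel V"
    unfolding V_def by (rule integrable_suminf[OF integrable_mult_right[OF int_diff(1)] AEV sint])
  then have V_meas [measurable]: "V \<in> borel_measurable borel" by auto
  have "(LINT x|lborel. V x) = (\<Sum>k. norm (a k) * fejer_modulus (r *\<^sub>R y k) / r ^ DIM('a))"
    unfolding V_def by (subst integral_suminf[OF integrable_mult_right[OF int_diff(1)] AEV sint])
      (simp add: int_diff)
  also have "\<dots> = W r / r ^ DIM('a)"
    unfolding W_def by (rule suminf_divide[OF sW])
  finally have int_V: "(LINT x|lborel. V x) = W r / r ^ DIM('a)" .
  \<comment> \<open>Splitting off one factor of \<open>V x\<close> and bounding the other p - 1
    powers by \<open>A\<close> leaves an expression linear in \<open>V x\<close>.\<close>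
  have bound: "norm (M \<xi>0 * f x - g x) powr p \<le> c powr p * A powr (p - 1) * V x" for x
  proof -
    have "norm (M \<xi>0 * f x - g x) powr p \<le> (c * V x) powr p"
      using dV p by (intro powr_mono2) auto
    also have "\<dots> = c powr p * (V x powr (p - 1) * V x)"
      using c V0[of x] p by (cases "V x = 0") (simp_all add: powr_mult powr_diff)
    also have "\<dots> \<le> c powr p * (A powr (p - 1) * V x)"
      using V0 VA p by (intro mult_left_mono mult_right_mono powr_mono2) auto
    finally show ?thesis by (simp add: mult.assoc)
  qed
  have int_d: "integrable lborel (\<lambda>x. norm (M \<xi>0 * f x - g x) powr p)"
    by (rule Bochner_Integration.integrable_bound[OF integrable_mult_right[OF V, of "c powr p * A powr (p - 1)"]])
      (use bound order_trans[OF bound abs_ge_self] in auto)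
  have "(LINT x|lborel. norm (M \<xi>0 * f x - g x) powr p) \<le> (LINT x|lborel. c powr p * A powr (p - 1) * V x)"
    by (intro integral_mono int_d integrable_mult_right V bound)
  \<comment> \<open>The Jacobian in the integral of \<open>V\<close> cancels against c^p = r^d /
    I.\<close>
  also have "\<dots> = A powr (p - 1) * W r / I"
    using c r I by (simp add: int_V)
  also have "\<dots> \<le> e powr p" using small by simp
  finally have "(LINT x|lborel. norm (M \<xi>0 * f x - g x) powr p) powr (1 / p) \<le> (e powr p) powr (1 / p)"
    using p by (intro powr_mono2) auto
  also have "\<dots> = e" using e p by (simp add: powr_powr)
  finally have "Lp_norm p (\<lambda>x. M \<xi>0 * f x - g x) \<le> ennreal e"
    by (subst Lp_normI) (auto intro: int_d ennreal_leI)
  with norm1 mult show ?thesis by (rule that)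
qed

text \<open>\<open>approximate_eigenfunction\<close> is applied at a frequency where the symbol
  takes the value \<open>lam\<close>, with arbitrarily small error.\<close>

theorem theorem1p2:
  fixes \<delta> p lam :: real
  assumes "\<delta> > 0" and "1 \<le> p" and "lam \<in> {0..1}"
  shows "(INF f \<in> {f :: 'a::euclidean_space \<Rightarrow> complex. Lp_norm p f = 1}.
            shifted_bochner_riesz_norm p lam \<delta> f) = 0"
proof -
  define m :: "'a \<Rightarrow> complex" where "m \<xi> = of_real (max (1 - (norm \<xi>)\<^sup>2) 0 powr \<delta>)" for \<xi>
  obtain \<xi>0 :: 'a and \<epsilon> C M where M: "0 < \<epsilon>" "trig_series C M" "M \<xi>0 = of_real lam"
    and loc: "\<And>\<xi>. (\<And>b. b \<in> Basis \<Longrightarrow> \<bar>(\<xi> - \<xi>0) \<bullet> b\<bar> \<le> \<epsilon>) \<Longrightarrow> m \<xi> = M \<xi>"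
    by (rule bochner_riesz_symbol_local[of \<delta> lam, where 'a = 'a, folded m_def]) (use assms in auto)
  have m: "m \<in> borel_measurable borel" unfolding m_def by measurable
  have m_le: "norm (m \<xi>) \<le> 1" for \<xi>
    unfolding m_def using assms by (simp add: powr_le1)
  \<comment> \<open>The summand 0 gives the bound the shape expected by
    \<open>ennreal_le_epsilon\<close>.\<close>
  have "(INF f \<in> {f :: 'a \<Rightarrow> complex. Lp_norm p f = 1}. shifted_bochner_riesz_norm p lam \<delta> f) \<le> 0 + ennreal e"
    if e: "0 < e" for e
  proof -
    obtain f g where fg: "Lp_norm p f = 1" "fourier_multiplier m f g"
      "Lp_norm p (\<lambda>x. M \<xi>0 * f x - g x) \<le> ennreal e"
      using approximate_eigenfunction[OF M(2,1) loc m m_le assms(2) e] by blast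
    have "shifted_bochner_riesz_norm p lam \<delta> f \<le> Lp_norm p (\<lambda>x. of_real lam * f x - g x)"
      unfolding shifted_bochner_riesz_norm_def
      using fg(2) by (intro INF_lower) (simp add: bochner_riesz_def m_def[abs_def])
    also have "\<dots> \<le> 0 + ennreal e" using fg(3) by (simp add: M(3))
    finally show ?thesis using fg(1) by (intro INF_lower2[of f]) auto
  qed
  then have "(INF f \<in> {f :: 'a \<Rightarrow> complex. Lp_norm p f = 1}. shifted_bochner_riesz_norm p lam \<delta> f) \<le> 0"
    by (rule ennreal_le_epsilon)
  then show ?thesis by simp
qed

end
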